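(* Let $d\ge3$ and suppose $C\in\mathcal{C}^d_{\rm c}$ satisfies $d_\infty(C,\psi(C))\ne0$. Then $C$ is a discontinuity point of the mapping $\psi:\mathcal{C}^d_{\rm c}\to\mathcal{C}^d_{\rm c}$ (with respect to $d_\infty$) assigning to every copula its partial vine copula of D-vine structure.
   Context: $\mathbb{I}=[0,1]$, $\lambda$ Lebesgue measure, $d_\infty$ the uniform distance between $d$-dimensional copulas. For a $d$-dimensional copula $C$ and $J\subseteq\{1,\dots,d\}$, $C_J$ is the marginal copula of the coordinates in $J$ and $\mu_{C_J}$ its measure. For $J$ with $|J|\ge2$ and $\emptyset\ne L\subseteq J$ with $|L|\le|J|-2$, $F_{j|L}(\cdot|\mathbf{t})$ ($j\in J\setminus L$) denote the univariate conditional distribution functions of coordinate $j$ given the coordinates in $L$ equal $\mathbf{t}$ (from a regular conditional distribution under $C_J$), and $C^{\mathbf{t}}_{J\setminus L;L}$ the copula of the conditional distribution of the coordinates $J\setminus L$ given $\mathbf{t}$. $\mathcal{C}^d_{\rm c}$ is the family of $d$-dimensional copulas for which all these conditional univariate distribution functions are continuous for $\mu_{C_L}$-a.e. $\mathbf{t}$. For $C\in\mathcal{C}^d_{\rm c}$ define $C^{\rm PVC}$ recursively: $(C^{\rm PVC})_{i,i+1}:=C_{i,i+1}$, $i=1,\dots,d-1$. For $k=2,\dots,d-1$, $i=1,\dots,d-k$, $M=\{i+1,\dots,i+k-1\}$: $(C_p)_{i,i+k}(a,b):=\int_{\mathbb{I}^{k-1}}C^{\mathbf{w}}_{\{i,i+k\};M}(a,b)\,d\mu_{(C^{\rm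 PVC})_M}(\mathbf{w})$ (for $k=2$ this measure is $\lambda$), and $(C^{\rm PVC})_{i,\dots,i+k}(u_i,\dots,u_{i+k}):=\int_{\times_{m\in M}[0,u_m]}(C_p)_{i,i+k}(F^{\rm PVC}_{i|M}(u_i|\mathbf{t}),F^{\rm PVC}_{i+k|M}(u_{i+k}|\mathbf{t}))\,d\mu_{(C^{\rm PVC})_M}(\mathbf{t})$, where $F^{\rm PVC}_{i|M}$, $F^{\rm PVC}_{i+k|M}$ are the conditional univariate distribution functions derived from the previously constructed $(C^{\rm PVC})_{i,\dots,i+k-1}$ resp. $(C^{\rm PVC})_{i+1,\dots,i+k}$. Then $\psi(C):=(C^{\rm PVC})_{1,\dots,d}$. *)

theory Defs
  imports "HOL-Probability.Probability"
begin

text \<open>Points of the unit cube indexed by a finite set J of coordinates are functions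
  nat \<Rightarrow> real; the ambient measurable space is the product PiM J of Borel spaces.\<close>

abbreviation cube :: "nat set \<Rightarrow> (nat \<Rightarrow> real) measure" where
  "cube J \<equiv> PiM J (\<lambda>_. borel)"

text \<open>A copula (identified with its probability measure) on the coordinates J:
  a probability measure on the product space whose one-dimensional margins are uniform on [0,1].\<close>

definition copula_on :: "nat set \<Rightarrow> (nat \<Rightarrow> real) measure \<Rightarrow> bool" where
  "copula_on J \<mu> \<longleftrightarrow> sets \<mu> = sets (cube J) \<and> prob_space \<mu> \<and>
     (\<forall>j\<in>J. \<forall>u\<in>{0..1}. measure \<mu> {x \<in> space \<mu>. x j \<le> u} = u)"

definition cdf_on :: "nat set \<Rightarrow> (nat \<Rightarrow> real) measure \<Rightarrow> (nat \<Rightarrow> real) \<Rightarrow> real" where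
  "cdf_on J \<mu> u = measure \<mu> {x \<in> space \<mu>. \<forall>j\<in>J. x j \<le> u j}"

definition dinf :: "nat \<Rightarrow> (nat \<Rightarrow> real) measure \<Rightarrow> (nat \<Rightarrow> real) measure \<Rightarrow> real" where
  "dinf d \<mu> \<nu> = (SUP u \<in> {u. \<forall>j\<in>{1..d}. u j \<in> {0..1}}.
                    \<bar>cdf_on {1..d} \<mu> u - cdf_on {1..d} \<nu> u\<bar>)"

definition marg :: "(nat \<Rightarrow> real) measure \<Rightarrow> nat set \<Rightarrow> (nat \<Rightarrow> real) measure" where
  "marg \<mu> L = distr \<mu> (cube L) (\<lambda>x. restrict x L)"

definition rcd :: "(nat \<Rightarrow> real) measure \<Rightarrow> nat set \<Rightarrow> nat set
                   \<Rightarrow> ((nat \<Rightarrow> real) \<Rightarrow> (nat \<Rightarrow> real) measure) \<Rightarrow> bool" where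
  "rcd \<mu> L R K \<longleftrightarrow> K \<in> measurable (cube L) (prob_algebra (cube R)) \<and>
     (\<forall>A\<in>sets (cube L). \<forall>B\<in>sets (cube R).
        emeasure \<mu> {x \<in> space \<mu>. restrict x L \<in> A \<and> restrict x R \<in> B}
        = (\<integral>\<^sup>+ t. indicator A t * emeasure (K t) B \<partial>marg \<mu> L))"

definition condF :: "((nat \<Rightarrow> real) \<Rightarrow> (nat \<Rightarrow> real) measure) \<Rightarrow> nat \<Rightarrow> real \<Rightarrow> (nat \<Rightarrow> real) \<Rightarrow> real" where
  "condF K j x t = measure (K t) {z \<in> space (K t). z j \<le> x}"

definition Cc :: "nat \<Rightarrow> (nat \<Rightarrow> real) measure set" where
  "Cc d = {\<mu>. copula_on {1..d} \<mu> \<and>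
     (\<forall>J L K. J \<subseteq> {1..d} \<and> 2 \<le> card J \<and> L \<noteq> {} \<and> L \<subseteq> J \<and> card L + 2 \<le> card J
        \<and> rcd \<mu> L (J - L) K \<longrightarrow>
        (\<forall>j\<in>J - L. AE t in marg \<mu> L. continuous_on UNIV (\<lambda>x. condF K j x t)))}"

definition copula2 :: "(real \<Rightarrow> real \<Rightarrow> real) \<Rightarrow> bool" where
  "copula2 D \<longleftrightarrow> (\<exists>\<nu>. copula_on {0, 1} \<nu> \<and>
     (\<forall>a b. D a b = measure \<nu> {x \<in> space \<nu>. x 0 \<le> a \<and> x 1 \<le> b}))"

text \<open>Copula of the bivariate conditional distribution K t of the coordinates (i, j)
  (the Sklar copula; unique when the conditional margins are continuous).\<close>

definition cond_cop :: "((nat \<Rightarrow> real) \<Rightarrow> (nat \<Rightarrow> real) measure) \<Rightarrow> nat \<Rightarrow> nat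
                        \<Rightarrow> (nat \<Rightarrow> real) \<Rightarrow> real \<Rightarrow> real \<Rightarrow> real" where
  "cond_cop K i j t = (THE D. copula2 D \<and>
     (\<forall>x y. measure (K t) {z \<in> space (K t). z i \<le> x \<and> z j \<le> y}
            = D (condF K i x t) (condF K j y t)))"

text \<open>is_PVC d \<mu> \<nu>: \<nu> is the partial vine copula of D-vine structure of \<mu>, built by the
  recursive construction for some choice of versions of the regular conditional
  distributions. P i k is the constructed copula (C^PVC) on the block {i..i+k}.\<close>

definition is_PVC :: "nat \<Rightarrow> (nat \<Rightarrow> real) measure \<Rightarrow> (nat \<Rightarrow> real) measure \<Rightarrow> bool" where
  "is_PVC d \<mu> \<nu> \<longleftrightarrow> (\<exists>P :: nat \<Rightarrow> nat \<Rightarrow> (nat \<Rightarrow> real) measure.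
     (\<forall>i. 1 \<le> i \<and> i \<le> d \<longrightarrow> P i 0 = marg \<mu> {i}) \<and>
     (\<forall>i. 1 \<le> i \<and> i + 1 \<le> d \<longrightarrow> P i 1 = marg \<mu> {i, i + 1}) \<and>
     (\<forall>k i. 2 \<le> k \<and> k \<le> d - 1 \<and> 1 \<le> i \<and> i + k \<le> d \<longrightarrow>
        copula_on {i..i+k} (P i k) \<and>
        (\<exists>Kc K1 K2.
           rcd \<mu> {i+1..i+k-1} {i, i+k} Kc \<and>
           rcd (P i (k - 1)) {i+1..i+k-1} {i} K1 \<and>
           rcd (P (i + 1) (k - 1)) {i+1..i+k-1} {i+k} K2 \<and>
           (let Cp = (\<lambda>a b. \<integral>w. cond_cop Kc i (i+k) w a b \<partial>P (i + 1) (k - 2))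
            in \<forall>u. (\<forall>j\<in>{i..i+k}. u j \<in> {0..1}) \<longrightarrow>
                 cdf_on {i..i+k} (P i k) u =
                 (\<integral>t. indicator {t. \<forall>m\<in>{i+1..i+k-1}. t m \<in> {0..u m}} t *
                       Cp (condF K1 i (u i) t) (condF K2 (i+k) (u (i+k)) t) \<partial>P (i + 1) (k - 2))))) \<and>
     \<nu> = P 1 (d - 1))"

end

theory Submission
  imports Defs
begin

text \<open>It suffices to approximate C in the uniform distance by copulas D in the same class with
  \<open>\<psi> D = D\<close>: then \<open>\<psi> D\<close> stays at distance about \<open>d\<^sub>\<infinity>(C, \<psi> C)\<close> from \<open>\<psi> C\<close>.
  Cut the cube into a fine grid and let \<open>p\<^sub>I\<close> be the C-mass of the cell I. For each coordinate j
  stack disjoint intervals of lengths \<open>p\<^sub>I\<close>, the one for I lying inside the j-th edge of I, and let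
  D be the mixture with weights \<open>p\<^sub>I\<close> of the uniform distributions on the products of these intervals.
  D gives every grid cell the same mass as C, hence is uniformly close to C. Since each single
  coordinate reveals I, the remaining coordinates are conditionally independent and uniform on
  intervals given any nonempty set of coordinates. So all conditional copulas of D are
  independence copulas and D is its own partial vine copula.\<close>

section \<open>Copulas determined by their distribution functions\<close>

text \<open>The intervals fit because C has uniform margins: the cells with the same index in
  direction j carry total mass \<open>1/N\<close>, exactly the length of that edge, so stacking them
  edge by edge keeps the margins of D uniform. Separation in every single coordinate is required
  because the recursion starts by conditioning on one coordinate only. The obstacle lies elsewhere.
  \<open>\<psi>\<close> is known only through \<open>is_PVC\<close>, which leaves the versions of
  all conditional distributions open. Hence every \<open>\<nu>\<close> with
  \<open>is_PVC d D \<nu>\<close> has to be identified with D, also for versions that behave badly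
  on null sets. The recursion formula then narrows each value of the distribution function down to
  finitely many candidates, and the continuity that comes with \<open>copula_on\<close> selects the
  right one.\<close>

definition orthant :: "nat set \<Rightarrow> (nat \<Rightarrow> real) \<Rightarrow> (nat \<Rightarrow> real) set" where
  "orthant J u = {x \<in> (\<Pi>\<^sub>E j\<in>J. UNIV). \<forall>j\<in>J. x j \<le> u j}"

lemma orthant_sets [measurable]: "finite J \<Longrightarrow> orthant J u \<in> sets (cube J)"
proof -
  assume "finite J"
  have "{x \<in> space (cube J). \<forall>j\<in>J. x j \<le> u j} \<in> sets (cube J)"
    using \<open>finite J\<close> by measurable
  then show ?thesis by (simp add: orthant_def space_PiM)
qed

lemma cdf_on_eq_orthant:
  assumes "sets M = sets (cube J)"
  shows "cdf_on J M u = measure M (orthant J u)"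
  using sets_eq_imp_space_eq[OF assms] by (simp add: cdf_on_def orthant_def space_PiM)

lemma ex_nat_bound_finite:
  fixes x :: "nat \<Rightarrow> real"
  assumes "finite J"
  shows "\<exists>n::nat. \<forall>i\<in>J. x i \<le> real n"
proof -
  obtain n :: nat where n: "(\<Sum>i\<in>J. \<bar>x i\<bar>) \<le> real n"
    using real_arch_simple by blast
  have "x i \<le> real n" if "i \<in> J" for i
    using member_le_sum[OF that, of "\<lambda>i. \<bar>x i\<bar>"] assms n by auto
  then show ?thesis by blast
qed

text \<open>Corners are taken rational to have countably many generators: an almost sure identity on
  each of them then holds on all of them off one null set.\<close>

lemma sets_cube_eq_sigma_rational_orthants:
  assumes fin: "finite J"
  shows "sets (cube J) = sigma_sets (\<Pi>\<^sub>E j\<in>J. UNIV) (orthant J ` (\<Pi>\<^sub>E j\<in>J. \<rat>))"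
proof (rule antisym)
  let ?\<Omega> = "\<Pi>\<^sub>E j\<in>J. (UNIV::real set)" and ?E = "orthant J ` (\<Pi>\<^sub>E j\<in>J. \<rat>)"
  have E: "?E \<subseteq> Pow ?\<Omega>" by (auto simp: orthant_def)
  show "sigma_sets ?\<Omega> ?E \<subseteq> sets (cube J)"
    using sets.sigma_sets_subset[of ?E "cube J"] orthant_sets[OF fin] by (auto simp: space_PiM)
  have "sets (cube J) \<subseteq> sets (sigma ?\<Omega> ?E)"
  proof (rule sets_PiM_in_sets)
    show "space (sigma ?\<Omega> ?E) = (\<Pi>\<^sub>E i\<in>J. space borel)"
      using E by (simp add: space_measure_of)
    fix j A assume j: "j \<in> J" and A: "A \<in> sets (borel :: real measure)"
    have "(\<lambda>x. x j) \<in> borel_measurable (sigma ?\<Omega> ?E)"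
    proof (rule borel_measurableI_le)
      fix y :: real
      let ?r = "\<lambda>q n. \<lambda>i\<in>J. if i = j then q else of_nat n :: real"
      \<comment> \<open>The union over \<open>n\<close> removes the bounds on the other coordinates;
        intersecting over rational \<open>q > y\<close> reaches the real bound
        \<open>y\<close>.\<close>
      have "{x \<in> ?\<Omega>. x j \<le> y} = ?\<Omega> \<inter> (\<Inter>q\<in>{q\<in>\<rat>. y < q}. \<Union>n::nat. orthant J (?r q n))"
      proof (intro antisym subsetI)
        fix x assume x: "x \<in> {x \<in> ?\<Omega>. x j \<le> y}"
        obtain n :: nat where n: "\<forall>i\<in>J. x i \<le> real n"
          using ex_nat_bound_finite[OF fin] by blast
        have "x \<in> orthant J (?r q n)" if "y < q" for q
          using x n that by (auto simp: orthant_def)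
        then show "x \<in> ?\<Omega> \<inter> (\<Inter>q\<in>{q\<in>\<rat>. y < q}. \<Union>n::nat. orthant J (?r q n))"
          using x by blast
      next
        fix x assume x: "x \<in> ?\<Omega> \<inter> (\<Inter>q\<in>{q\<in>\<rat>. y < q}. \<Union>n::nat. orthant J (?r q n))"
        have le: "x j \<le> q" if "q \<in> \<rat>" "y < q" for q
          using x that j by (fastforce simp: orthant_def)
        have "x j \<le> y"
        proof (rule ccontr)
          assume "\<not> x j \<le> y"
          then obtain q where "q \<in> \<rat>" "y < q" "q < x j"
            using Rats_dense_in_real[of y "x j"] by auto
          with le[of q] show False by auto
        qed
        with x show "x \<in> {x \<in> ?\<Omega>. x j \<le> y}" by auto
      qed
      also have "\<dots> \<in> sets (sigma ?\<Omega> ?E)"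
      proof (rule sets.Int)
        show "?\<Omega> \<in> sets (sigma ?\<Omega> ?E)"
          using E sets.top[of "sigma ?\<Omega> ?E"] by (simp add: space_measure_of)
        have "countable {q\<in>\<rat>. y < q}"
          by (rule countable_subset[OF _ countable_rat]) auto
        moreover have "{q\<in>\<rat>. y < q} \<noteq> {}"
          using Rats_dense_in_real[of y "y + 1"] by auto
        moreover have "orthant J (?r q n) \<in> sets (sigma ?\<Omega> ?E)" if "q \<in> \<rat>" for q n
          using that E by (intro in_measure_of) auto
        ultimately show "(\<Inter>q\<in>{q\<in>\<rat>. y < q}. \<Union>n::nat. orthant J (?r q n)) \<in> sets (sigma ?\<Omega> ?E)"
          by (intro sets.countable_INT'' sets.countable_INT' sets.countable_UN) auto
      qed
      finally show "{x \<in> space (sigma ?\<Omega> ?E). x j \<le> y} \<in> sets (sigma ?\<Omega> ?E)"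
        using E by (simp add: space_measure_of)
    qed
    from measurable_sets[OF this A]
    show "{x \<in> space (sigma ?\<Omega> ?E). x j \<in> A} \<in> sets (sigma ?\<Omega> ?E)"
      by (simp add: vimage_def Int_def conj_commute)
  qed
  then show "sets (cube J) \<subseteq> sigma_sets ?\<Omega> ?E"
    using E by simp
qed

text \<open>Rational orthants are closed under intersection, by taking minima of corners, and they
  exhaust the space, so a generator argument applies.\<close>

lemma prob_eqI_rational_orthants:
  assumes fin: "finite J"
    and M: "prob_space M" "sets M = sets (cube J)" and N: "prob_space N" "sets N = sets (cube J)"
    and eq: "\<And>u. u \<in> (\<Pi>\<^sub>E j\<in>J. \<rat>) \<Longrightarrow> emeasure M (orthant J u) = emeasure N (orthant J u)"
  shows "M = N"
proof (rule measure_eqI_generator_eq[where E = "orthant J ` (\<Pi>\<^sub>E j\<in>J. \<rat>)" and \<Omega> = "\<Pi>\<^sub>E j\<in>J. UNIV"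
      and A = "\<lambda>n. orthant J (\<lambda>j\<in>J. of_nat n)"])
  interpret M: prob_space M by fact
  show "Int_stable (orthant J ` (\<Pi>\<^sub>E j\<in>J. \<rat>))"
  proof (rule Int_stableI_image)
    fix u v :: "nat \<Rightarrow> real" assume uv: "u \<in> (\<Pi>\<^sub>E j\<in>J. \<rat>)" "v \<in> (\<Pi>\<^sub>E j\<in>J. \<rat>)"
    have "(\<lambda>j\<in>J. min (u j) (v j)) \<in> (\<Pi>\<^sub>E j\<in>J. \<rat>)"
      using uv by (auto simp: min_def PiE_iff)
    moreover have "orthant J u \<inter> orthant J v = orthant J (\<lambda>j\<in>J. min (u j) (v j))"
      by (auto simp: orthant_def)
    ultimately show "\<exists>k\<in>\<Pi>\<^sub>E j\<in>J. \<rat>. orthant J u \<inter> orthant J v = orthant J k" by blast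
  qed
  show "(\<Union>n. orthant J (\<lambda>j\<in>J. of_nat n)) = (\<Pi>\<^sub>E j\<in>J. UNIV)"
    using ex_nat_bound_finite[OF fin] by (auto simp: orthant_def)
  show "emeasure M (orthant J (\<lambda>j\<in>J. of_nat n)) \<noteq> \<infinity>" for n
    by simp
  show "range (\<lambda>n. orthant J (\<lambda>j\<in>J. of_nat n)) \<subseteq> orthant J ` (\<Pi>\<^sub>E j\<in>J. \<rat>)"
    by (intro image_subsetI imageI) auto
  show "orthant J ` (\<Pi>\<^sub>E j\<in>J. \<rat>) \<subseteq> Pow (\<Pi>\<^sub>E j\<in>J. UNIV)"
    by (auto simp: orthant_def)
qed (use assms in \<open>auto simp: sets_cube_eq_sigma_rational_orthants\<close>)

lemma copula_on_AE:
  assumes "copula_on J \<mu>" "j \<in> J"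
  shows "AE x in \<mu>. 0 < x j \<and> x j \<le> 1"
proof -
  interpret prob_space \<mu> using assms by (simp add: copula_on_def)
  have [measurable_cong]: "sets \<mu> = sets (cube J)" using assms by (simp add: copula_on_def)
  have "measure \<mu> {x \<in> space \<mu>. x j \<le> 0} = 0" "measure \<mu> {x \<in> space \<mu>. x j \<le> 1} = 1"
    using assms by (auto simp: copula_on_def)
  moreover have "{x \<in> space \<mu>. x j \<le> 0} \<in> events" "{x \<in> space \<mu>. x j \<le> 1} \<in> events"
    using \<open>j \<in> J\<close> by measurable
  ultimately have "AE x in \<mu>. \<not> x j \<le> 0" "AE x in \<mu>. x j \<le> 1"
    by (auto simp: prob_eq_0 prob_Collect_eq_1)
  then show ?thesis by eventually_elim auto
qed

text \<open>Almost every point has all coordinates in (0,1], so moving the corner of an orthant to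
  the nearest point of the unit cube does not change its mass.\<close>

lemma copula_on_eqI:
  assumes fin: "finite J" and \<mu>: "copula_on J \<mu>" and \<nu>: "copula_on J \<nu>"
    and eq: "\<And>u. (\<And>j. j \<in> J \<Longrightarrow> u j \<in> {0..1}) \<Longrightarrow> cdf_on J \<mu> u = cdf_on J \<nu> u"
  shows "\<mu> = \<nu>"
proof -
  have *: "measure M (orthant J u) = cdf_on J M (\<lambda>j. max 0 (min 1 (u j)))" if M: "copula_on J M" for M u
  proof -
    interpret prob_space M using M by (simp add: copula_on_def)
    have s[measurable_cong]: "sets M = sets (cube J)" using M by (simp add: copula_on_def)
    have "AE x in M. \<forall>j\<in>J. 0 < x j \<and> x j \<le> 1"
      using fin copula_on_AE[OF M] by (intro AE_finite_allI) auto
    then have "AE x in M. (x \<in> orthant J u) = (x \<in> orthant J (\<lambda>j. max 0 (min 1 (u j))))"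
    proof eventually_elim
      case (elim x)
      have "x j \<le> u j \<longleftrightarrow> x j \<le> max 0 (min 1 (u j))" if "j \<in> J" for j
        using bspec[OF elim that] by (auto simp: max_def min_def)
      then show ?case by (simp add: orthant_def)
    qed
    then show ?thesis
      unfolding cdf_on_eq_orthant[OF s]
      by (intro measure_eq_AE) (simp_all add: s orthant_sets[OF fin])
  qed
  have "prob_space \<mu>" "prob_space \<nu>" "sets \<mu> = sets (cube J)" "sets \<nu> = sets (cube J)"
    using \<mu> \<nu> by (auto simp: copula_on_def)
  moreover have "emeasure \<mu> (orthant J u) = emeasure \<nu> (orthant J u)" for u
    using *[OF \<mu>, of u] *[OF \<nu>, of u] eq[of "\<lambda>j. max 0 (min 1 (u j))"] calculation
    by (simp add: finite_measure.emeasure_eq_measure prob_space.finite_measure)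
  ultimately show ?thesis
    using prob_eqI_rational_orthants[OF fin] by blast
qed

text \<open>Passing from \<open>v\<close> to \<open>u\<close> adds at most the slabs
  \<open>v j < x j \<le> u j\<close>, and uniform margins bound the mass of each by its thickness.
  This serves both the comparison on a grid and the continuity argument for subsums.\<close>

lemma copula_cdf_lipschitz:
  assumes fin: "finite J" and \<mu>: "copula_on J \<mu>"
    and u: "\<And>j. j \<in> J \<Longrightarrow> u j \<in> {0..1}" and v: "\<And>j. j \<in> J \<Longrightarrow> v j \<in> {0..1}"
  shows "\<bar>cdf_on J \<mu> u - cdf_on J \<mu> v\<bar> \<le> (\<Sum>j\<in>J. \<bar>u j - v j\<bar>)"
proof -
  interpret prob_space \<mu> using \<mu> by (simp add: copula_on_def)
  have s[measurable_cong]: "sets \<mu> = sets (cube J)" using \<mu> by (simp add: copula_on_def)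
  have *: "cdf_on J \<mu> u \<le> cdf_on J \<mu> v + (\<Sum>j\<in>J. \<bar>u j - v j\<bar>)"
    if u: "\<And>j. j \<in> J \<Longrightarrow> u j \<in> {0..1}" and v: "\<And>j. j \<in> J \<Longrightarrow> v j \<in> {0..1}" for u v
  proof -
    let ?S = "\<lambda>j. {x \<in> space \<mu>. v j < x j \<and> x j \<le> u j}"
    have S[measurable]: "?S j \<in> events" if "j \<in> J" for j
      using that by measurable
    have "prob (?S j) \<le> \<bar>u j - v j\<bar>" if j: "j \<in> J" for j
    proof (cases "v j \<le> u j")
      case True
      let ?A = "\<lambda>c. {x \<in> space \<mu>. x j \<le> c}"
      have A: "?A c \<in> events" for c using j by measurable
      have "prob (?S j) = prob (?A (u j) - ?A (v j))"
        by (intro arg_cong[where f=prob]) auto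
      also have "\<dots> = prob (?A (u j)) - prob (?A (v j))"
        using A True by (intro finite_measure_Diff) auto
      also have "\<dots> = u j - v j"
        using \<mu> j u[OF j] v[OF j] by (simp add: copula_on_def)
      finally show ?thesis by simp
    next
      case False
      then have "?S j = {}" by auto
      then show ?thesis by (simp only: measure_empty abs_ge_zero)
    qed
    then have 1: "(\<Sum>j\<in>J. prob (?S j)) \<le> (\<Sum>j\<in>J. \<bar>u j - v j\<bar>)"
      by (rule sum_mono)
    have sub: "orthant J u \<subseteq> orthant J v \<union> (\<Union>j\<in>J. ?S j)"
      using sets_eq_imp_space_eq[OF s] by (auto simp: orthant_def space_PiM)
    have ov: "orthant J v \<in> events" using orthant_sets[OF fin] s by simp
    have "prob (orthant J u) \<le> prob (orthant J v \<union> (\<Union>j\<in>J. ?S j))"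
      using sub ov S fin by (intro finite_measure_mono) auto
    also have "\<dots> \<le> prob (orthant J v) + prob (\<Union>j\<in>J. ?S j)"
      using ov S fin by (intro measure_Un_le) auto
    also have "prob (\<Union>j\<in>J. ?S j) \<le> (\<Sum>j\<in>J. prob (?S j))"
      using S fin by (intro measure_UNION_le) auto
    finally show ?thesis using 1 by (simp add: cdf_on_eq_orthant[OF s])
  qed
  show ?thesis
    using *[of u v] *[of v u] u v by (simp add: abs_le_iff abs_minus_commute)
qed

section \<open>Almost sure uniqueness of regular conditional distributions\<close>

text \<open>For fixed \<open>B\<close> both kernels are densities, with respect to the marginal, of
  the same measure in \<open>A\<close>, hence agree almost surely. The exceptional set depends on
  \<open>B\<close>; letting \<open>B\<close> run through the countably many rational orthants leaves
  one null set.\<close>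

lemma rcd_AE_unique:
  assumes fin: "finite L" "finite R" and \<mu>: "prob_space \<mu>" "sets \<mu> = sets (cube J)" and LJ: "L \<subseteq> J"
    and K: "rcd \<mu> L R K" and K': "rcd \<mu> L R K'"
  shows "AE t in marg \<mu> L. K t = K' t"
proof -
  interpret prob_space \<mu> by fact
  have r: "(\<lambda>x. restrict x L) \<in> measurable \<mu> (cube L)"
    using measurable_restrict_subset[OF LJ] \<mu>(2) by (simp cong: measurable_cong_sets)
  interpret PL: prob_space "marg \<mu> L"
    unfolding marg_def by (rule prob_space_distr[OF r])
  have sL[measurable_cong]: "sets (marg \<mu> L) = sets (cube L)" by (simp add: marg_def)
  have m[measurable]: "K \<in> measurable (cube L) (prob_algebra (cube R))"
      "K' \<in> measurable (cube L) (prob_algebra (cube R))"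
    using K K' by (auto simp: rcd_def)
  have eq: "AE t in marg \<mu> L. emeasure (K t) B = emeasure (K' t) B" if B: "B \<in> sets (cube R)" for B
  proof (rule PL.density_unique_finite_measure)
    have [measurable]: "K \<in> measurable (cube L) (subprob_algebra (cube R))"
      "K' \<in> measurable (cube L) (subprob_algebra (cube R))"
      using m by (auto intro: measurable_prob_algebraD)
    show "(\<lambda>t. emeasure (K t) B) \<in> borel_measurable (marg \<mu> L)"
      "(\<lambda>t. emeasure (K' t) B) \<in> borel_measurable (marg \<mu> L)"
      using B by measurable
    show "(\<integral>\<^sup>+t. emeasure (K t) B * indicator A t \<partial>marg \<mu> L) = (\<integral>\<^sup>+t. emeasure (K' t) B * indicator A t \<partial>marg \<mu> L)"
      if "A \<in> sets (marg \<mu> L)" for A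
    proof -
      have "A \<in> sets (cube L)" using that by (simp add: sL)
      with K K' B have "(\<integral>\<^sup>+t. indicator A t * emeasure (K t) B \<partial>marg \<mu> L) = (\<integral>\<^sup>+t. indicator A t * emeasure (K' t) B \<partial>marg \<mu> L)"
        unfolding rcd_def by (metis (no_types, lifting))
      then show ?thesis by (simp add: mult.commute)
    qed
  qed auto
  have "countable (\<Pi>\<^sub>E j\<in>R. \<rat> :: real set)"
    using fin countable_rat by (intro countable_PiE) auto
  then have "AE t in marg \<mu> L. \<forall>u\<in>\<Pi>\<^sub>E j\<in>R. \<rat>. emeasure (K t) (orthant R u) = emeasure (K' t) (orthant R u)"
    using eq orthant_sets[OF fin(2)] by (intro AE_ball_countable[THEN iffD2]) auto
  with AE_space show ?thesis
  proof eventually_elim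
    case (elim t)
    have "t \<in> space (cube L)" using elim sets_eq_imp_space_eq[OF sL] by simp
    then have "K t \<in> space (prob_algebra (cube R))" "K' t \<in> space (prob_algebra (cube R))"
      using m[THEN measurable_space] by auto
    then show ?case
      using elim by (intro prob_eqI_rational_orthants[OF fin(2)]) (auto simp: space_prob_algebra)
  qed
qed

lemma copula_cdf_one:
  assumes fin: "finite J" and \<mu>: "copula_on J \<mu>"
  shows "cdf_on J \<mu> (\<lambda>_. 1) = 1"
proof -
  interpret prob_space \<mu> using \<mu> by (simp add: copula_on_def)
  have s: "sets \<mu> = sets (cube J)" using \<mu> by (simp add: copula_on_def)
  have "AE x in \<mu>. \<forall>j\<in>J. 0 < x j \<and> x j \<le> 1"
    using fin copula_on_AE[OF \<mu>] by (intro AE_finite_allI) auto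
  with AE_space have "AE x in \<mu>. x \<in> orthant J (\<lambda>_. 1)"
    by eventually_elim (use sets_eq_imp_space_eq[OF s] in \<open>auto simp: orthant_def space_PiM\<close>)
  then show ?thesis
    unfolding cdf_on_eq_orthant[OF s]
    by (intro prob_eq_1[THEN iffD2]) (auto simp: s orthant_sets[OF fin])
qed

section \<open>Default values of integrals, and continuity of subsums\<close>

text \<open>Equality almost everywhere does not transfer measurability to \<open>f\<close>, as the
  measure may be incomplete; where it fails, the Bochner integral takes the default value 0.\<close>

lemma integral_eq_or_zero_AE:
  fixes f g :: "'a \<Rightarrow> real"
  assumes "AE x in M. f x = g x" "g \<in> borel_measurable M"
  shows "integral\<^sup>L M f = integral\<^sup>L M g \<or> integral\<^sup>L M f = 0"
proof (cases "f \<in> borel_measurable M")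
  case True
  then show ?thesis using assms integral_cong_AE by blast
next
  case False
  then have "\<not> integrable M f" by auto
  then show ?thesis by (simp add: not_integrable_integral_eq)
qed

text \<open>A summand cannot begin to be missing: just after the last point where the full sum is
  attained, some missing summand is positive and at most the deficit; but it was already positive at
  that point, while the deficit tends to 0 there.\<close>

lemma subset_sum_continuation:
  fixes c :: "'i \<Rightarrow> real \<Rightarrow> real"
  assumes fin: "finite S"
    and cont: "\<And>i. i \<in> S \<Longrightarrow> continuous_on {0..1} (c i)"
    and nonneg: "\<And>i s. i \<in> S \<Longrightarrow> s \<in> {0..1} \<Longrightarrow> 0 \<le> c i s"
    and anti: "\<And>i s t. i \<in> S \<Longrightarrow> 0 \<le> s \<Longrightarrow> s \<le> t \<Longrightarrow> t \<le> 1 \<Longrightarrow> c i t \<le> c i s"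
    and g: "continuous_on {0..1} g" and g0: "g 0 = (\<Sum>i\<in>S. c i 0)"
    and sub: "\<And>s. s \<in> {0..1} \<Longrightarrow> \<exists>T\<subseteq>S. g s = (\<Sum>i\<in>T. c i s)"
  shows "g 1 = (\<Sum>i\<in>S. c i 1)"
proof (rule ccontr)
  define h where "h s = (\<Sum>i\<in>S. c i s) - g s" for s
  assume "g 1 \<noteq> (\<Sum>i\<in>S. c i 1)"
  then have h1: "h 1 \<noteq> 0" by (simp add: h_def)
  have h_cont: "continuous_on {0..1} h"
    unfolding h_def using cont g by (intro continuous_intros)
  define Z where "Z = {s \<in> {0..1}. h s = 0}"
  have "closed Z"
    unfolding Z_def using continuous_closed_preimage_constant[OF h_cont, of 0] by simp
  moreover have "bounded Z" by (rule bounded_subset[of "{0..1}"]) (auto simp: Z_def)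
  ultimately have "compact Z" by (simp add: compact_eq_bounded_closed)
  moreover have "0 \<in> Z" using g0 by (simp add: Z_def h_def)
  ultimately obtain s0 where s0: "s0 \<in> Z" "\<And>s. s \<in> Z \<Longrightarrow> s \<le> s0"
    using compact_attains_sup[of Z] by blast
  have s01: "0 \<le> s0" "s0 < 1" "h s0 = 0"
    using s0 h1 by (auto simp: Z_def less_le)
  have above: "\<exists>i\<in>S. 0 < c i s \<and> c i s \<le> h s" if s: "s0 < s" "s \<le> 1" for s
  proof -
    have s': "s \<in> {0..1}" using s s01 by auto
    then obtain T where T: "T \<subseteq> S" "g s = (\<Sum>i\<in>T. c i s)" using sub by blast
    have h: "h s = (\<Sum>i\<in>S - T. c i s)"
      using T fin by (simp add: h_def sum_diff)
    have "h s \<noteq> 0" using s0(2)[of s] s s' by (auto simp: Z_def)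
    then obtain i where i: "i \<in> S - T" "c i s \<noteq> 0"
      using h sum.neutral by metis
    moreover have "c i s \<le> h s"
      unfolding h using i fin nonneg s' by (intro member_le_sum) auto
    ultimately show ?thesis using nonneg[of i s] s' by (intro bexI[of _ i]) auto
  qed
  \<comment> \<open>Since the summands are antitone, one that is positive after \<open>s0\<close> is
    positive at \<open>s0\<close>. So \<open>Q\<close> contains every candidate for the missing
    summand, and being finite it allows one neighbourhood for all of them.\<close>
  define Q where "Q = {i \<in> S. 0 < c i s0}"
  have "\<forall>\<^sub>F s in at s0 within {0..1}. h s < c i s" if "i \<in> Q" for i
  proof (rule order_tendstoD(2)[THEN eventually_mono])
    show "((\<lambda>s. h s - c i s) \<longlongrightarrow> h s0 - c i s0) (at s0 within {0..1})"
    proof (rule tendsto_diff)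
      show "(h \<longlongrightarrow> h s0) (at s0 within {0..1})"
        using h_cont s01 unfolding continuous_on by (metis atLeastAtMost_iff less_imp_le)
      show "(c i \<longlongrightarrow> c i s0) (at s0 within {0..1})"
        using cont[of i] that s01 unfolding continuous_on Q_def by (metis (no_types, lifting) atLeastAtMost_iff less_imp_le mem_Collect_eq)
    qed
    show "h s0 - c i s0 < 0" using that s01 by (simp add: Q_def)
  qed auto
  then have "\<forall>\<^sub>F s in at s0 within {0..1}. \<forall>i\<in>Q. h s < c i s"
    using fin by (intro eventually_ball_finite) (auto simp: Q_def)
  then obtain e where e: "e > 0"
    "\<And>s. s \<in> {0..1} \<Longrightarrow> s \<noteq> s0 \<Longrightarrow> dist s s0 < e \<Longrightarrow> \<forall>i\<in>Q. h s < c i s"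
    unfolding eventually_at by metis
  define s where "s = min 1 (s0 + e / 2)"
  have s: "s0 < s" "s \<le> 1" "dist s s0 < e"
    using e(1) s01 by (auto simp: s_def dist_real_def min_def)
  obtain i where i: "i \<in> S" "0 < c i s" "c i s \<le> h s" using above s by blast
  then have "i \<in> Q" using anti[of i s0 s] s s01 by (auto simp: Q_def)
  with e(2)[of s] s s01 i show False by fastforce
qed

section \<open>Independence in products and the independence copula\<close>

text \<open>The event depends on the coordinates in \<open>L \<union> R\<close> only; splitting
  these by \<open>merge\<close> turns it into the rectangle \<open>A \<times> B\<close> of a binary
  product.\<close>

lemma (in product_prob_space) emeasure_PiM_restrict_restrict:
  assumes fin: "finite J" and sub: "L \<union> R \<subseteq> J" and disj: "L \<inter> R = {}"
    and A: "A \<in> sets (PiM L M)" and B: "B \<in> sets (PiM R M)"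
  shows "emeasure (PiM J M) {x \<in> space (PiM J M). restrict x L \<in> A \<and> restrict x R \<in> B}
    = emeasure (PiM L M) A * emeasure (PiM R M) B"
proof -
  have finLR: "finite L" "finite R" using fin sub by (auto intro: finite_subset)
  interpret R: prob_space "PiM R M" by (rule prob_space_PiM) (rule prob_space)
  let ?X = "{x \<in> space (PiM (L \<union> R) M). restrict x L \<in> A \<and> restrict x R \<in> B}"
  have rL: "(\<lambda>x. restrict x L) \<in> measurable (PiM (L \<union> R) M) (PiM L M)"
    and rR: "(\<lambda>x. restrict x R) \<in> measurable (PiM (L \<union> R) M) (PiM R M)"
    by (auto intro: measurable_restrict_subset)
  have X: "?X \<in> sets (PiM (L \<union> R) M)"
  proof -
    have "?X = ((\<lambda>x. restrict x L) -` A \<inter> space (PiM (L \<union> R) M)) \<inter> ((\<lambda>x. restrict x R) -` B \<inter> space (PiM (L \<union> R) M))"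
      by auto
    then show ?thesis
      using sets.Int[OF measurable_sets[OF rL A] measurable_sets[OF rR B]] by simp
  qed
  have "emeasure (PiM J M) {x \<in> space (PiM J M). restrict x L \<in> A \<and> restrict x R \<in> B}
      = emeasure (PiM J M) (prod_emb J M (L \<union> R) ?X)"
  proof (intro arg_cong[where f="emeasure (PiM J M)"] set_eqI)
    fix x :: "'i \<Rightarrow> 'a"
    have "restrict (restrict x (L \<union> R)) L = restrict x L" "restrict (restrict x (L \<union> R)) R = restrict x R"
      by (simp_all add: Int_absorb1)
    moreover have "restrict x (L \<union> R) \<in> space (PiM (L \<union> R) M)" if "x \<in> space (PiM J M)"
      using that sub by (auto simp: space_PiM)
    ultimately show "x \<in> {x \<in> space (PiM J M). restrict x L \<in> A \<and> restrict x R \<in> B} \<longleftrightarrow> x \<in> prod_emb J M (L \<union> R) ?X"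
      by (auto simp: prod_emb_iff space_PiM PiE_iff)
  qed
  also have "\<dots> = emeasure (PiM (L \<union> R) M) ?X"
    using sub fin X by (intro emeasure_prod_emb) auto
  also have "\<dots> = emeasure (PiM L M \<Otimes>\<^sub>M PiM R M) (A \<times> B)"
  proof (subst distr_merge[OF disj finLR, symmetric], subst emeasure_distr)
    show "emeasure (PiM L M \<Otimes>\<^sub>M PiM R M) (merge L R -` ?X \<inter> space (PiM L M \<Otimes>\<^sub>M PiM R M))
      = emeasure (PiM L M \<Otimes>\<^sub>M PiM R M) (A \<times> B)"
    proof (intro arg_cong[where f="emeasure _"] set_eqI)
      fix p
      have AB: "A \<subseteq> space (PiM L M)" "B \<subseteq> space (PiM R M)"
        using A B sets.sets_into_space by auto
      have "restrict (merge L R (a, b)) L = a" "restrict (merge L R (a, b)) R = b"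
        if "a \<in> space (PiM L M)" "b \<in> space (PiM R M)" for a b
        using that disj by (auto simp: space_PiM PiE_iff extensional_restrict)
      moreover have "merge L R (a, b) \<in> space (PiM (L \<union> R) M)"
        if "a \<in> space (PiM L M)" "b \<in> space (PiM R M)" for a b
        using measurable_space[OF measurable_merge, of "(a,b)" L M R] that by (simp add: space_pair_measure)
      ultimately show "p \<in> merge L R -` ?X \<inter> space (PiM L M \<Otimes>\<^sub>M PiM R M) \<longleftrightarrow> p \<in> A \<times> B"
        using subsetD[OF AB(1)] subsetD[OF AB(2)] by (cases p) (auto simp: space_pair_measure)
    qed
  qed (use X in auto)
  also have "\<dots> = emeasure (PiM L M) A * emeasure (PiM R M) B"
    using A B by (rule R.emeasure_pair_measure_Times)
  finally show ?thesis .
qed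

definition independence_copula :: "(nat \<Rightarrow> real) measure" where
  "independence_copula = PiM {0, 1} (\<lambda>_. uniform_measure lborel {0..1})"

lemma measure_uniform_unit_atMost:
  "u \<in> {0..1} \<Longrightarrow> measure (uniform_measure lborel {0..1::real}) {..u} = u"
proof -
  assume u: "u \<in> {0..1}"
  then have "{0..1} \<inter> {..u} = {0..u}" by auto
  then show ?thesis using u by simp
qed

lemma independence_copula:
  "copula_on {0, 1} independence_copula"
  "\<And>a b. a \<in> {0..1} \<Longrightarrow> b \<in> {0..1} \<Longrightarrow>
    measure independence_copula {x \<in> space independence_copula. x 0 \<le> a \<and> x 1 \<le> b} = a * b"
proof -
  interpret P: product_prob_space "\<lambda>_::nat. uniform_measure lborel {0..1::real}" "{0,1}"
    by (intro product_prob_space.intro product_prob_space_axioms.intro product_sigma_finite.intro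
        prob_space_imp_sigma_finite prob_space_uniform_measure) auto
  have s: "sets independence_copula = sets (cube {0,1})"
    unfolding independence_copula_def by (intro sets_PiM_cong) auto
  have em: "measure independence_copula {x \<in> space independence_copula. \<forall>j\<in>J. x j \<in> X j}
    = (\<Prod>j\<in>J. measure (uniform_measure lborel {0..1}) (X j))"
    if "J \<subseteq> {0,1}" "\<And>j. X j \<in> sets borel" for J and X :: "nat \<Rightarrow> real set"
    unfolding independence_copula_def measure_def using that
    by (subst P.emeasure_PiM_Collect)
      (auto simp: finite_subset[of J "{0,1}"] P.M.emeasure_eq_measure prod_ennreal prod_nonneg simp del: emeasure_uniform_measure)
  show "copula_on {0, 1} independence_copula"
    unfolding copula_on_def
  proof (intro conjI ballI s)
    show "prob_space independence_copula"
      unfolding independence_copula_def by (rule P.prob_space_axioms)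
    fix j u :: real assume "u \<in> {0..1}"
    fix j :: nat assume "j \<in> {0,1}"
    then show "measure independence_copula {x \<in> space independence_copula. x j \<le> u} = u"
      using em[of "{j}" "\<lambda>_. {..u}"] measure_uniform_unit_atMost[OF \<open>u \<in> {0..1}\<close>]
      by (simp del: measure_uniform_measure)
  qed
  fix a b :: real assume "a \<in> {0..1}" "b \<in> {0..1}"
  then show "measure independence_copula {x \<in> space independence_copula. x 0 \<le> a \<and> x 1 \<le> b} = a * b"
    using em[of "{0,1}" "\<lambda>j. if j = 0 then {..a} else {..b}"] measure_uniform_unit_atMost
    by (simp del: measure_uniform_measure)
qed

text \<open>\<open>cond_cop\<close> is a definite description, so uniqueness is half of the work:
  the conditional margins attain every value of the unit interval, which forces any candidate to be
  the product on the unit square.\<close>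

lemma cond_cop_independent:
  assumes indep: "\<And>x y. measure (K t) {z \<in> space (K t). z i \<le> x \<and> z j \<le> y} = condF K i x t * condF K j y t"
    and range_i: "range (\<lambda>x. condF K i x t) = {0..1}" and range_j: "range (\<lambda>x. condF K j x t) = {0..1}"
    and ab: "a \<in> {0..1}" "b \<in> {0..1}"
  shows "cond_cop K i j t a b = a * b"
proof -
  define Q where "Q a b = measure independence_copula {x \<in> space independence_copula. x 0 \<le> a \<and> x 1 \<le> b}" for a b
  have "cond_cop K i j t = Q"
    unfolding cond_cop_def
  proof (rule the_equality)
    show "copula2 Q \<and> (\<forall>x y. measure (K t) {z \<in> space (K t). z i \<le> x \<and> z j \<le> y} = Q (condF K i x t) (condF K j y t))"
      using independence_copula range_i range_j rangeI[of "\<lambda>x. condF K i x t"] rangeI[of "\<lambda>x. condF K j x t"]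
      by (auto simp: copula2_def Q_def indep)
  next
    fix D assume D: "copula2 D \<and> (\<forall>x y. measure (K t) {z \<in> space (K t). z i \<le> x \<and> z j \<le> y} = D (condF K i x t) (condF K j y t))"
    then obtain \<nu> where \<nu>: "copula_on {0,1} \<nu>" "\<And>a b. D a b = measure \<nu> {x \<in> space \<nu>. x 0 \<le> a \<and> x 1 \<le> b}"
      unfolding copula2_def by auto
    have "D a b = a * b" if ab: "a \<in> {0..1}" "b \<in> {0..1}" for a b
    proof -
      obtain x y where "a = condF K i x t" "b = condF K j y t"
        using ab range_i range_j by (metis (no_types, lifting) imageE)
      with D show ?thesis by (simp add: indep)
    qed
    \<comment> \<open>Candidates are functions of all real arguments, but the product formula is
      known on the unit square only; equality of the underlying measures settles the rest.\<close>
    then have "\<nu> = independence_copula"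
      using \<nu> independence_copula by (intro copula_on_eqI[of "{0,1}"]) (auto simp: cdf_on_def)
    then show "D = Q" using \<nu>(2) by (intro ext) (simp add: Q_def)
  qed
  then show ?thesis using independence_copula(2)[OF ab] by (simp add: Q_def)
qed

section \<open>Mixtures of products with disjoint supports\<close>

text \<open>Index \<open>i\<close> is drawn from \<open>q\<close>, then each coordinate
  \<open>j\<close> independently from \<open>U j i\<close>; \<open>idx_U\<close> expresses disjoint
  supports by letting \<open>idx j\<close> recover \<open>i\<close> from coordinate \<open>j\<close>
  alone. As \<open>idx\<close> may leave the support of \<open>q\<close>, each \<open>U j i\<close>
  is a probability measure, which makes \<open>ker\<close> a probability kernel at every
  point.\<close>

locale disjoint_mixture =
  fixes q :: "'i pmf" and U :: "nat \<Rightarrow> 'i \<Rightarrow> real measure" and idx :: "nat \<Rightarrow> real \<Rightarrow> 'i"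
  assumes finite_support: "finite (set_pmf q)"
    and prob_U: "\<And>j i. prob_space (U j i)"
    and sets_U: "\<And>j i. sets (U j i) = sets borel"
    and U_unit: "\<And>j i. AE x in U j i. 0 < x \<and> x \<le> 1"
    and cont_U: "\<And>j i. continuous_on UNIV (\<lambda>x. measure (U j i) {..x})"
    and idx_measurable: "\<And>j. idx j \<in> measurable borel (count_space UNIV)"
    and idx_U: "\<And>j i. i \<in> set_pmf q \<Longrightarrow> AE x in U j i. idx j x = i"
    and uniform_margins: "\<And>j u. u \<in> {0..1} \<Longrightarrow> (\<Sum>i\<in>set_pmf q. pmf q i * measure (U j i) {..u}) = u"
begin

definition F :: "nat \<Rightarrow> 'i \<Rightarrow> real \<Rightarrow> real" where
  "F j i x = measure (U j i) {..x}"

definition piece :: "nat set \<Rightarrow> 'i \<Rightarrow> (nat \<Rightarrow> real) measure" where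
  "piece J i = PiM J (\<lambda>j. U j i)"

definition mix :: "nat set \<Rightarrow> (nat \<Rightarrow> real) measure" where
  "mix J = measure_pmf q \<bind> piece J"

text \<open>The conditional law of \<open>R\<close> depends on the condition only through the index,
  and any one conditioning coordinate \<open>l\<close> reveals it; different choices of
  \<open>l\<close> agree almost surely under the mixture.\<close>

definition ker :: "nat \<Rightarrow> nat set \<Rightarrow> (nat \<Rightarrow> real) \<Rightarrow> (nat \<Rightarrow> real) measure" where
  "ker l R t = piece R (idx l (t l))"

lemma product_prob_U: "product_prob_space (\<lambda>j. U j i)"
  by (intro product_prob_space.intro product_prob_space_axioms.intro product_sigma_finite.intro
      prob_space_imp_sigma_finite prob_U)

lemma F_bounds: "0 \<le> F j i x" "F j i x \<le> 1"
  using prob_space.prob_le_1[OF prob_U] by (auto simp: F_def)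

lemma F_mono: "x \<le> y \<Longrightarrow> F j i x \<le> F j i y"
  unfolding F_def by (rule finite_measure.finite_measure_mono)
    (auto simp: prob_space.finite_measure prob_U sets_U)

text \<open>Intermediate values between 0 and 1. Surjectivity is what makes the copula of a product
  of two such laws unique.\<close>

lemma range_F: "range (F j i) = {0..1}"
proof -
  interpret prob_space "U j i" by (rule prob_U)
  have "AE x in U j i. x \<notin> {..0}" "AE x in U j i. x \<in> {..1}"
    using U_unit[of j i] by (auto elim!: eventually_mono)
  then have 01: "F j i 0 = 0" "F j i 1 = 1"
    unfolding F_def by (simp_all add: prob_eq_0 prob_eq_1 sets_U)
  have "\<exists>x\<ge>0. x \<le> 1 \<and> F j i x = a" if "a \<in> {0..1}" for a
    using cont_U[of j i] that 01 unfolding F_def[symmetric, abs_def]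
    by (intro IVT') (auto intro: continuous_on_subset)
  then show ?thesis using F_bounds by fastforce
qed

lemma sets_piece [measurable_cong, simp]: "sets (piece J i) = sets (cube J)"
  unfolding piece_def by (intro sets_PiM_cong) (auto simp: sets_U)

lemma prob_piece: "prob_space (piece J i)"
  unfolding piece_def by (intro prob_space_PiM prob_U)

lemma piece_in_prob_algebra: "piece J i \<in> space (prob_algebra (cube J))"
  by (simp add: space_prob_algebra prob_piece)

lemma piece_measurable: "piece J \<in> measurable (measure_pmf q) (subprob_algebra (cube J))"
  by (auto simp: space_subprob_algebra prob_piece prob_space_imp_subprob_space)

lemma sets_mix [measurable_cong, simp]: "sets (mix J) = sets (cube J)"
  unfolding mix_def by (intro sets_bind) auto

lemma space_piece: "space (piece J i) = (\<Pi>\<^sub>E j\<in>J. UNIV)"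
  using sets_eq_imp_space_eq[OF sets_piece] by (simp add: space_PiM)

lemma space_mix: "space (mix J) = (\<Pi>\<^sub>E j\<in>J. UNIV)"
  using sets_eq_imp_space_eq[OF sets_mix] by (simp add: space_PiM)

lemma emeasure_mix:
  "X \<in> sets (cube J) \<Longrightarrow> emeasure (mix J) X = (\<integral>\<^sup>+i. emeasure (piece J i) X \<partial>measure_pmf q)"
  unfolding mix_def by (rule emeasure_bind[OF _ piece_measurable]) auto

lemma prob_mix: "prob_space (mix J)"
proof
  have "space (mix J) = space (piece J i)" for i by (simp add: space_mix space_piece)
  then have "emeasure (mix J) (space (mix J)) = (\<integral>\<^sup>+i. emeasure (piece J i) (space (piece J i)) \<partial>measure_pmf q)"
    by (subst emeasure_mix) (metis sets.top sets_mix, simp)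
  then show "emeasure (mix J) (space (mix J)) = 1"
    by (simp add: prob_space.emeasure_space_1[OF prob_piece])
qed

lemma measure_mix:
  assumes "X \<in> sets (cube J)"
  shows "measure (mix J) X = (\<Sum>i\<in>set_pmf q. pmf q i * measure (piece J i) X)"
proof -
  have "ennreal (measure (mix J) X) = emeasure (mix J) X"
    by (simp add: finite_measure.emeasure_eq_measure prob_space.finite_measure prob_mix)
  also have "\<dots> = (\<Sum>i\<in>set_pmf q. emeasure (piece J i) X * ennreal (pmf q i))"
    unfolding emeasure_mix[OF assms] by (rule nn_integral_measure_pmf_finite[OF finite_support]) simp
  also have "\<dots> = ennreal (\<Sum>i\<in>set_pmf q. pmf q i * measure (piece J i) X)"
    by (simp add: finite_measure.emeasure_eq_measure prob_space.finite_measure prob_piece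
        ennreal_mult[symmetric] mult.commute sum_ennreal)
  finally show ?thesis
    by (subst (asm) ennreal_inj) (auto intro!: sum_nonneg)
qed

lemma measure_piece_Collect:
  assumes "finite L" "L \<subseteq> J"
  shows "measure (piece J i) {x \<in> space (piece J i). \<forall>j\<in>L. x j \<le> u j} = (\<Prod>j\<in>L. F j i (u j))"
proof -
  interpret product_prob_space "\<lambda>j. U j i" J by (rule product_prob_U)
  have "emeasure (piece J i) {x \<in> space (piece J i). \<forall>j\<in>L. x j \<in> {..u j}} = (\<Prod>j\<in>L. emeasure (U j i) {..u j})"
    unfolding piece_def using assms by (intro emeasure_PiM_Collect) (auto simp: sets_U)
  then show ?thesis
    by (simp add: finite_measure.emeasure_eq_measure prob_space.finite_measure prob_piece prob_U
        F_def prod_ennreal prod_nonneg ennreal_inj)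
qed

lemma measure_piece_orthant:
  "finite J \<Longrightarrow> measure (piece J i) (orthant J u) = (\<Prod>j\<in>J. F j i (u j))"
  using measure_piece_Collect[of J J i u] by (simp add: orthant_def space_piece)

lemma cdf_mix:
  "finite J \<Longrightarrow> cdf_on J (mix J) u = (\<Sum>i\<in>set_pmf q. pmf q i * (\<Prod>j\<in>J. F j i (u j)))"
  by (simp add: cdf_on_eq_orthant measure_mix orthant_sets measure_piece_orthant)

lemma copula_mix: "copula_on J (mix J)"
  unfolding copula_on_def
proof (intro conjI ballI sets_mix prob_mix)
  fix j u assume j: "j \<in> J" and u: "u \<in> {0..1::real}"
  have "measure (piece J i) {x \<in> space (mix J). x j \<le> u} = F j i u" for i
    using measure_piece_Collect[of "{j}" J i "\<lambda>_. u"] j by (simp add: space_mix space_piece)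
  moreover have "{x \<in> space (cube J). x j \<le> u} \<in> sets (cube J)"
    using j by measurable
  ultimately show "measure (mix J) {x \<in> space (mix J). x j \<le> u} = u"
    using uniform_margins[OF u, of j] by (simp add: measure_mix space_mix space_PiM F_def)
qed

lemma AE_piece_idx:
  assumes "l \<in> J" "i \<in> set_pmf q"
  shows "AE t in piece J i. idx l (t l) = i"
  unfolding piece_def using idx_U[OF assms(2)] assms(1)
  by (intro AE_PiM_component[where P="\<lambda>x. idx l x = i"] prob_U)

lemma idx_component_measurable:
  "l \<in> J \<Longrightarrow> (\<lambda>t. idx l (t l)) \<in> measurable (cube J) (count_space UNIV)"
  by (rule measurable_compose[OF _ idx_measurable]) (rule measurable_component_singleton)

lemma AE_mix_iff:
  "Measurable.pred (cube J) P \<Longrightarrow> (AE x in mix J. P x) \<longleftrightarrow> (\<forall>i\<in>set_pmf q. AE x in piece J i. P x)"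
  unfolding mix_def by (simp add: AE_bind[OF piece_measurable] AE_measure_pmf_iff)

lemma AE_mix_idx:
  assumes l: "l \<in> J"
  shows "AE t in mix J. idx l (t l) \<in> set_pmf q"
proof (subst AE_mix_iff)
  note [measurable] = idx_component_measurable[OF l]
  show "Measurable.pred (cube J) (\<lambda>t. idx l (t l) \<in> set_pmf q)" by measurable
  show "\<forall>i\<in>set_pmf q. AE t in piece J i. idx l (t l) \<in> set_pmf q"
  proof
    fix i assume i: "i \<in> set_pmf q"
    show "AE t in piece J i. idx l (t l) \<in> set_pmf q"
      using AE_piece_idx[OF l i] by eventually_elim (simp add: i)
  qed
qed

text \<open>Only piece \<open>i\<close> charges the set where the revealed index is
  \<open>i\<close>, so intersecting an orthant with that set isolates one summand of the
  mixture.\<close>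

lemma measure_mix_cell:
  assumes fin: "finite J" and l: "l \<in> J" and i: "i \<in> set_pmf q"
  shows "orthant J u \<inter> {t \<in> space (cube J). idx l (t l) = i} \<in> sets (cube J)"
    and "measure (mix J) (orthant J u \<inter> {t \<in> space (cube J). idx l (t l) = i}) = pmf q i * (\<Prod>j\<in>J. F j i (u j))"
proof -
  note [measurable] = idx_component_measurable[OF l]
  let ?X = "orthant J u \<inter> {t \<in> space (cube J). idx l (t l) = i}"
  have "{t \<in> space (cube J). idx l (t l) = i} \<in> sets (cube J)" by measurable
  then show X: "?X \<in> sets (cube J)" using orthant_sets[OF fin] by auto
  have "measure (piece J i') ?X = (if i' = i then measure (piece J i) (orthant J u) else 0)"
    if i': "i' \<in> set_pmf q" for i'
  proof -
    interpret prob_space "piece J i'" by (rule prob_piece)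
    note AE = AE_piece_idx[OF l i']
    show ?thesis
    proof (cases "i' = i")
      case True
      have "AE x in piece J i'. (x \<in> ?X) = (x \<in> orthant J u)"
        using AE by eventually_elim (auto simp: True orthant_def space_PiM)
      then show ?thesis using X orthant_sets[OF fin] True by (auto intro!: measure_eq_AE)
    next
      case False
      have "AE x in piece J i'. x \<notin> ?X"
        using AE by eventually_elim (auto simp: False)
      then show ?thesis using False X by (simp add: prob_eq_0)
    qed
  qed
  then have "measure (mix J) ?X = (\<Sum>i'\<in>set_pmf q. if i' = i then pmf q i * measure (piece J i) (orthant J u) else 0)"
    unfolding measure_mix[OF X] by (intro sum.cong) auto
  then show "measure (mix J) ?X = pmf q i * (\<Prod>j\<in>J. F j i (u j))"
    using i finite_support by (simp add: measure_piece_orthant[OF fin])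
qed

lemma marg_mix:
  assumes "finite J" "L \<subseteq> J"
  shows "marg (mix J) L = mix L"
proof -
  have "distr (piece J i) (cube L) (\<lambda>x. restrict x L) = piece L i" for i
  proof -
    interpret product_prob_space "\<lambda>j. U j i" J by (rule product_prob_U)
    have "distr (piece J i) (cube L) (\<lambda>x. restrict x L) = distr (piece J i) (piece L i) (\<lambda>x. restrict x L)"
      by (intro distr_cong) auto
    then show ?thesis
      unfolding piece_def using distr_restrict[OF assms(2,1)] by simp
  qed
  then show ?thesis
    unfolding marg_def mix_def
    by (subst distr_bind[OF piece_measurable _ measurable_restrict_subset[OF assms(2)]]) auto
qed

text \<open>Within one piece the coordinates in \<open>L\<close> and in \<open>R\<close> are
  independent, and there the kernel is almost surely the constant \<open>R\<close>-product of the
  same piece; averaging over the index gives the claim.\<close>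

lemma rcd_mix:
  assumes fin: "finite J" and sub: "L \<union> R \<subseteq> J" and disj: "L \<inter> R = {}" and l: "l \<in> L"
  shows "rcd (mix J) L R (ker l R)"
  unfolding rcd_def
proof (intro conjI ballI)
  show K: "ker l R \<in> measurable (cube L) (prob_algebra (cube R))"
    unfolding ker_def
    by (rule measurable_compose[OF idx_component_measurable[OF l]]) (simp add: piece_in_prob_algebra)
  fix A B assume A: "A \<in> sets (cube L)" and B: "B \<in> sets (cube R)"
  have finL: "finite L" using fin sub finite_subset by auto
  have sp: "space (mix J) = space (piece J i)" for i by (simp add: space_mix space_piece)
  let ?X = "{x \<in> space (mix J). restrict x L \<in> A \<and> restrict x R \<in> B}"
  have rL: "(\<lambda>x. restrict x L) \<in> measurable (cube J) (cube L)"
    and rR: "(\<lambda>x. restrict x R) \<in> measurable (cube J) (cube R)"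
    using sub by (auto intro: measurable_restrict_subset)
  have "?X = ((\<lambda>x. restrict x L) -` A \<inter> space (cube J)) \<inter> ((\<lambda>x. restrict x R) -` B \<inter> space (cube J))"
    by (auto simp: space_mix space_PiM)
  then have X: "?X \<in> sets (cube J)"
    using sets.Int[OF measurable_sets[OF rL A] measurable_sets[OF rR B]] by simp
  have pieces: "emeasure (piece J i) ?X = emeasure (piece L i) A * emeasure (piece R i) B" for i
  proof -
    interpret product_prob_space "\<lambda>j. U j i" J by (rule product_prob_U)
    show ?thesis
      unfolding sp[of i] piece_def
      using A B sets_piece[of L i] sets_piece[of R i]
      by (intro emeasure_PiM_restrict_restrict[OF fin sub disj]) (simp_all add: piece_def)
  qed
  have [measurable]: "ker l R \<in> measurable (cube L) (subprob_algebra (cube R))"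
    using K by (rule measurable_prob_algebraD)
  have f[measurable]: "(\<lambda>t. indicator A t * emeasure (ker l R t) B) \<in> borel_measurable (cube L)"
    using A B by measurable
  have "(\<integral>\<^sup>+t. indicator A t * emeasure (ker l R t) B \<partial>marg (mix J) L)
      = (\<integral>\<^sup>+i. \<integral>\<^sup>+t. indicator A t * emeasure (ker l R t) B \<partial>piece L i \<partial>measure_pmf q)"
    using marg_mix[OF fin, of L] sub unfolding mix_def
    by (simp add: nn_integral_bind[OF f piece_measurable])
  also have "\<dots> = (\<integral>\<^sup>+i. emeasure (piece L i) A * emeasure (piece R i) B \<partial>measure_pmf q)"
  proof (rule nn_integral_cong_AE, rule AE_pmfI)
    fix i assume i: "i \<in> set_pmf q"
    have "(\<integral>\<^sup>+t. indicator A t * emeasure (ker l R t) B \<partial>piece L i)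
        = (\<integral>\<^sup>+t. indicator A t * emeasure (piece R i) B \<partial>piece L i)"
      using AE_piece_idx[OF l i] by (intro nn_integral_cong_AE) (auto elim: eventually_mono simp: ker_def)
    also have "\<dots> = emeasure (piece L i) A * emeasure (piece R i) B"
      using A by (subst nn_integral_multc) auto
    finally show "(\<integral>\<^sup>+t. indicator A t * emeasure (ker l R t) B \<partial>piece L i)
      = emeasure (piece L i) A * emeasure (piece R i) B" .
  qed
  also have "\<dots> = emeasure (mix J) ?X"
    by (simp add: emeasure_mix[OF X] pieces)
  finally show "emeasure (mix J) ?X = (\<integral>\<^sup>+t. indicator A t * emeasure (ker l R t) B \<partial>marg (mix J) L)" ..
qed

text \<open>Both \<open>Cc\<close> and \<open>is_PVC\<close> speak of arbitrary versions; up to a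
  null set, each of them is the explicit kernel.\<close>

lemma AE_rcd_mix:
  assumes fin: "finite J" and sub: "L \<union> R \<subseteq> J" and disj: "L \<inter> R = {}" and l: "l \<in> L"
    and K: "rcd (mix J) L R K"
  shows "AE t in mix L. K t = ker l R t"
proof -
  have "AE t in marg (mix J) L. K t = ker l R t"
    using fin sub by (intro rcd_AE_unique[where J=J and R=R and \<mu>="mix J"] K rcd_mix[OF fin sub disj l] prob_mix)
      (auto intro: finite_subset)
  moreover have "marg (mix J) L = mix L" using marg_mix[OF fin, of L] sub by simp
  ultimately show ?thesis by metis
qed

lemma condF_ker:
  assumes "K t = ker l R t" "j \<in> R"
  shows "condF K j x t = F j (idx l (t l)) x"
  using measure_piece_Collect[of "{j}" R "idx l (t l)" "\<lambda>_. x"] assms by (simp add: condF_def ker_def)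

lemma mix_in_Cc: "mix {1..d} \<in> Cc d"
  unfolding Cc_def
proof (intro CollectI conjI allI impI ballI copula_mix)
  fix J L K j
  assume A: "J \<subseteq> {1..d} \<and> 2 \<le> card J \<and> L \<noteq> {} \<and> L \<subseteq> J \<and> card L + 2 \<le> card J
        \<and> rcd (mix {1..d}) L (J - L) K" and j: "j \<in> J - L"
  then obtain l where l: "l \<in> L" by auto
  have marg: "marg (mix {1..d}) L = mix L"
    using A by (intro marg_mix) auto
  have "AE t in mix L. K t = ker l (J - L) t"
    using A l by (intro AE_rcd_mix[of "{1..d}"]) auto
  then show "AE t in marg (mix {1..d}) L. continuous_on UNIV (\<lambda>x. condF K j x t)"
    unfolding marg
  proof eventually_elim
    case (elim t)
    have "condF K j x t = measure (U j (idx l (t l))) {..x}" for x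
      using condF_ker[of K t l "J - L" j, OF elim j] by (simp add: F_def)
    then show ?case using cont_U[of j "idx l (t l)"] by simp
  qed
qed

section \<open>The partial vine copula of a mixture\<close>

lemma cond_cop_ker:
  assumes K: "K t = ker l {i, j} t" and ij: "i \<noteq> j" and ab: "a \<in> {0..1}" "b \<in> {0..1}"
  shows "cond_cop K i j t a b = a * b"
proof (rule cond_cop_independent[OF _ _ _ ab])
  have cF: "condF K i x t = F i (idx l (t l)) x" "condF K j x t = F j (idx l (t l)) x" for x
    using condF_ker[of K t l "{i, j}", OF K] by auto
  show "range (\<lambda>x. condF K i x t) = {0..1}" "range (\<lambda>x. condF K j x t) = {0..1}"
    using range_F by (simp_all add: cF)
  show "measure (K t) {z \<in> space (K t). z i \<le> x \<and> z j \<le> y} = condF K i x t * condF K j y t" for x y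
    using measure_piece_Collect[of "{i, j}" "{i, j}" "idx l (t l)" "\<lambda>m. if m = i then x else y"] ij
    by (simp add: cF K ker_def)
qed

text \<open>Regular conditional distributions are arbitrary on null sets, where \<^const>\<open>cond_cop\<close> need
  not depend measurably on the condition; the Bochner integral of a non-measurable function is 0.
  Hence at each point the integrals in the recursion only yield some subsum of the desired sum.\<close>

lemma PVC_integral_subsum:
  fixes u :: "nat \<Rightarrow> real"
  assumes M: "finite M" "l \<in> M" and ij: "i \<notin> M" "j \<notin> M" "i \<noteq> j"
    and Kc: "AE t in mix M. Kc t = ker l {i, j} t"
    and K1: "AE t in mix M. K1 t = ker l {i} t"
    and K2: "AE t in mix M. K2 t = ker l {j} t"
    and Cp: "Cp = (\<lambda>a b. \<integral>w. cond_cop Kc i j w a b \<partial>mix M)"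
  shows "\<exists>T\<subseteq>set_pmf q.
    (\<integral>t. indicator {t. \<forall>m\<in>M. t m \<in> {0..u m}} t * Cp (condF K1 i (u i) t) (condF K2 j (u j) t) \<partial>mix M)
    = (\<Sum>n\<in>T. pmf q n * (\<Prod>m\<in>insert i (insert j M). F m n (u m)))"
proof -
  interpret prob_space "mix M" by (rule prob_mix)
  \<comment> \<open>Which alternative holds may vary with \<open>a\<close> and \<open>b\<close>,
    since it hinges on measurability in \<open>w\<close> of the conditional copula at these
    arguments.\<close>
  have Cp_values: "Cp a b = a * b \<or> Cp a b = 0" if "a \<in> {0..1}" "b \<in> {0..1}" for a b
  proof -
    have "AE w in mix M. cond_cop Kc i j w a b = a * b"
      using Kc by eventually_elim (rule cond_cop_ker[OF _ ij(3) that])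
    from integral_eq_or_zero_AE[OF this] show ?thesis by (simp add: Cp prob_space)
  qed
  define c where "c n = Cp (F i n (u i)) (F j n (u j))" for n
  let ?cell = "\<lambda>n. orthant M u \<inter> {t \<in> space (cube M). idx l (t l) = n}"
  \<comment> \<open>On the cell with index \<open>n\<close> both conditional margins are almost
    surely constant in \<open>t\<close>, so the integrand is a step function up to a null set;
    \<open>g\<close> is its measurable version.\<close>
  define g where "g t = (\<Sum>n\<in>set_pmf q. c n * indicator (?cell n) t)" for t
  have cell: "?cell n \<in> events" if "n \<in> set_pmf q" for n
    using measure_mix_cell(1)[OF M that] by simp
  have "AE t in mix M. \<forall>m\<in>M. 0 < t m \<and> t m \<le> 1"
    using M copula_on_AE[OF copula_mix] by (intro AE_finite_allI) auto
  with K1 K2 AE_mix_idx[OF M(2)] AE_space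
  have ae: "AE t in mix M. indicator {t. \<forall>m\<in>M. t m \<in> {0..u m}} t * Cp (condF K1 i (u i) t) (condF K2 j (u j) t) = g t"
  proof eventually_elim
    case (elim t)
    have "g t = (\<Sum>n\<in>set_pmf q. if n = idx l (t l) then c n * indicator (orthant M u) t else 0)"
      unfolding g_def using elim by (intro sum.cong) (auto simp: indicator_def space_mix space_PiM)
    also have "\<dots> = c (idx l (t l)) * indicator (orthant M u) t"
      using elim finite_support by simp
    \<comment> \<open>Almost sure positivity of the coordinates turns the box of the recursion into
      an orthant.\<close>
    also have "indicator (orthant M u) t = (indicator {t. \<forall>m\<in>M. t m \<in> {0..u m}} t :: real)"
      using elim by (auto simp: indicator_def orthant_def space_mix less_imp_le)
    finally show ?case
      using condF_ker[of K1 t l "{i}" i] condF_ker[of K2 t l "{j}" j] elim by (simp add: c_def)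
  qed
  have meas: "g \<in> borel_measurable (mix M)"
    unfolding g_def[abs_def] using cell by (intro borel_measurable_sum borel_measurable_times) auto
  have int_g: "integral\<^sup>L (mix M) g = (\<Sum>n\<in>set_pmf q. c n * (pmf q n * (\<Prod>m\<in>M. F m n (u m))))"
  proof -
    have "integral\<^sup>L (mix M) g = (\<Sum>n\<in>set_pmf q. \<integral>t. c n * indicator (?cell n) t \<partial>mix M)"
      unfolding g_def[abs_def] using cell by (intro Bochner_Integration.integral_sum) (auto simp: emeasure_eq_measure)
    also have "\<dots> = (\<Sum>n\<in>set_pmf q. c n * prob (?cell n))"
      using cell sets.sets_into_space[OF cell] by (intro sum.cong) (auto simp: Int_absorb2)
    finally show ?thesis using measure_mix_cell(2)[OF M] by simp
  qed
  have ex_T: "\<exists>T\<subseteq>set_pmf q. (\<Sum>n\<in>set_pmf q. c n * (pmf q n * (\<Prod>m\<in>M. F m n (u m))))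
    = (\<Sum>n\<in>T. pmf q n * (\<Prod>m\<in>insert i (insert j M). F m n (u m)))"
  proof (intro exI conjI)
    \<comment> \<open>These are the indices at which \<open>Cp\<close> takes the product value;
      elsewhere \<open>c n\<close> is 0 and the summand drops out.\<close>
    let ?T = "{n \<in> set_pmf q. c n = F i n (u i) * F j n (u j)}"
    show "?T \<subseteq> set_pmf q" by auto
    have "c n * (pmf q n * (\<Prod>m\<in>M. F m n (u m)))
      = (if n \<in> ?T then pmf q n * (\<Prod>m\<in>insert i (insert j M). F m n (u m)) else 0)" if "n \<in> set_pmf q" for n
      using Cp_values[of "F i n (u i)" "F j n (u j)"] F_bounds M ij that by (auto simp: c_def)
    then show "(\<Sum>n\<in>set_pmf q. c n * (pmf q n * (\<Prod>m\<in>M. F m n (u m))))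
      = (\<Sum>n\<in>?T. pmf q n * (\<Prod>m\<in>insert i (insert j M). F m n (u m)))"
      using finite_support by (subst sum.inter_filter) (auto intro!: sum.cong)
  qed
  from integral_eq_or_zero_AE[OF ae meas] show ?thesis
  proof
    assume "(\<integral>t. indicator {t. \<forall>m\<in>M. t m \<in> {0..u m}} t * Cp (condF K1 i (u i) t) (condF K2 j (u j) t) \<partial>mix M)
      = integral\<^sup>L (mix M) g"
    then show ?thesis using ex_T int_g by simp
  next
    assume "(\<integral>t. indicator {t. \<forall>m\<in>M. t m \<in> {0..u m}} t * Cp (condF K1 i (u i) t) (condF K2 j (u j) t) \<partial>mix M) = 0"
    \<comment> \<open>The default value 0 of the outer integral is matched by the empty
      subsum.\<close>
    then show ?thesis by (intro exI[of _ "{}"]) simp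
  qed
qed

text \<open>A copula all of whose values are subsums of those of the mixture is the mixture itself:
  on the segment from (1,...,1) to u, subsums cannot change continuously.\<close>

lemma copula_subsum_eq_mix:
  assumes fin: "finite J" and \<nu>: "copula_on J \<nu>"
    and sub: "\<And>u. (\<And>j. j \<in> J \<Longrightarrow> u j \<in> {0..1}) \<Longrightarrow>
      \<exists>T\<subseteq>set_pmf q. cdf_on J \<nu> u = (\<Sum>n\<in>T. pmf q n * (\<Prod>j\<in>J. F j n (u j)))"
  shows "\<nu> = mix J"
proof (rule copula_on_eqI[OF fin \<nu> copula_mix])
  fix u :: "nat \<Rightarrow> real" assume u: "\<And>j. j \<in> J \<Longrightarrow> u j \<in> {0..1}"
  \<comment> \<open>At \<open>s = 0\<close> this is the corner (1,...,1), where both distribution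
    functions are 1 and so the full sum is attained; no coordinate increases with \<open>s\<close>,
    which makes the summands antitone.\<close>
  define v where "v s j = 1 - s * (1 - u j)" for s j
  have v: "v s j \<in> {0..1}" if "s \<in> {0..1}" "j \<in> J" for s j
    using u[OF that(2)] that(1) mult_le_one[of s "1 - u j"] by (auto simp: v_def)
  have v_anti: "v t j \<le> v s j" if "s \<le> t" "j \<in> J" for s t j
    using u[OF that(2)] that(1) by (auto simp: v_def intro: mult_right_mono)
  have "cdf_on J \<nu> (v 1) = (\<Sum>n\<in>set_pmf q. pmf q n * (\<Prod>j\<in>J. F j n (v 1 j)))"
  proof (rule subset_sum_continuation[where c = "\<lambda>n s. pmf q n * (\<Prod>j\<in>J. F j n (v s j))" and g = "\<lambda>s. cdf_on J \<nu> (v s)"])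
    show "finite (set_pmf q)" by (rule finite_support)
    show "continuous_on {0..1} (\<lambda>s. pmf q n * (\<Prod>j\<in>J. F j n (v s j)))" for n
      unfolding v_def F_def
      by (intro continuous_intros continuous_on_compose2[OF cont_U]) auto
    show "0 \<le> pmf q n * (\<Prod>j\<in>J. F j n (v s j))" for n s
      by (intro mult_nonneg_nonneg prod_nonneg) (auto simp: F_bounds)
    show "pmf q n * (\<Prod>j\<in>J. F j n (v t j)) \<le> pmf q n * (\<Prod>j\<in>J. F j n (v s j))" if "s \<le> t" for n s t
      using that v_anti F_bounds by (intro mult_left_mono prod_mono) (auto intro: F_mono)
    have lip: "dist (cdf_on J \<nu> (v s)) (cdf_on J \<nu> (v t)) \<le> card J * dist s t" if st: "s \<in> {0..1}" "t \<in> {0..1}" for s t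
    proof -
      have "\<bar>cdf_on J \<nu> (v s) - cdf_on J \<nu> (v t)\<bar> \<le> (\<Sum>j\<in>J. \<bar>v s j - v t j\<bar>)"
        using v st by (intro copula_cdf_lipschitz[OF fin \<nu>]) auto
      also have "\<dots> \<le> (\<Sum>j\<in>J. \<bar>s - t\<bar>)"
      proof (rule sum_mono)
        fix j assume "j \<in> J"
        have "v s j - v t j = (t - s) * (1 - u j)" by (simp add: v_def algebra_simps)
        then show "\<bar>v s j - v t j\<bar> \<le> \<bar>s - t\<bar>"
          using u[OF \<open>j \<in> J\<close>] by (simp add: abs_mult abs_minus_commute mult_left_le)
      qed
      finally show ?thesis by (simp add: dist_real_def)
    qed
    show "continuous_on {0..1} (\<lambda>s. cdf_on J \<nu> (v s))"
      by (rule lipschitz_on_continuous_on[of "card J"], rule lipschitz_onI) (use lip in auto)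
    have "v 0 = (\<lambda>_. 1)" by (auto simp: v_def)
    then show "cdf_on J \<nu> (v 0) = (\<Sum>n\<in>set_pmf q. pmf q n * (\<Prod>j\<in>J. F j n (v 0 j)))"
      using copula_cdf_one[OF fin \<nu>] copula_cdf_one[OF fin copula_mix] cdf_mix[OF fin, of "v 0"] by simp
    show "\<exists>T\<subseteq>set_pmf q. cdf_on J \<nu> (v s) = (\<Sum>n\<in>T. pmf q n * (\<Prod>j\<in>J. F j n (v s j)))" if "s \<in> {0..1}" for s
      using v that by (intro sub) auto
  qed
  moreover have "v 1 = u" by (auto simp: v_def)
  ultimately show "cdf_on J \<nu> u = cdf_on J (mix J) u"
    using cdf_mix[OF fin, of u] by simp
qed

text \<open>Induction on the block length: once the shorter blocks are mixtures, all three
  conditional distributions in the recursion are versions of kernels read off the coordinate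
  \<open>i + 1\<close>, which lies in \<open>M\<close> because \<open>2 \<le> k\<close>. The
  recursion then yields subsums, and the copula property of the block leaves only the
  mixture.\<close>

lemma is_PVC_mix:
  assumes d: "1 \<le> d" and PVC: "is_PVC d (mix {1..d}) \<nu>"
  shows "\<nu> = mix {1..d}"
proof -
  obtain P where
      P0: "\<forall>i. 1 \<le> i \<and> i \<le> d \<longrightarrow> P i 0 = marg (mix {1..d}) {i}"
    and P1: "\<forall>i. 1 \<le> i \<and> i + 1 \<le> d \<longrightarrow> P i 1 = marg (mix {1..d}) {i, i + 1}"
    and Pk: "\<forall>k i. 2 \<le> k \<and> k \<le> d - 1 \<and> 1 \<le> i \<and> i + k \<le> d \<longrightarrow>
        copula_on {i..i+k} (P i k) \<and>
        (\<exists>Kc K1 K2.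
           rcd (mix {1..d}) {i+1..i+k-1} {i, i+k} Kc \<and>
           rcd (P i (k - 1)) {i+1..i+k-1} {i} K1 \<and>
           rcd (P (i + 1) (k - 1)) {i+1..i+k-1} {i+k} K2 \<and>
           (let Cp = (\<lambda>a b. \<integral>w. cond_cop Kc i (i+k) w a b \<partial>P (i + 1) (k - 2))
            in \<forall>u. (\<forall>j\<in>{i..i+k}. u j \<in> {0..1}) \<longrightarrow>
                 cdf_on {i..i+k} (P i k) u =
                 (\<integral>t. indicator {t. \<forall>m\<in>{i+1..i+k-1}. t m \<in> {0..u m}} t *
                       Cp (condF K1 i (u i) t) (condF K2 (i+k) (u (i+k)) t) \<partial>P (i + 1) (k - 2))))"
    and \<nu>: "\<nu> = P 1 (d - 1)"
    using PVC unfolding is_PVC_def by (elim exE conjE) (rule that)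
  have "P i k = mix {i..i+k}" if "1 \<le> i" "i + k \<le> d" for i k
    using that
  proof (induction k arbitrary: i rule: less_induct)
    case (less k i)
    consider "k = 0" | "k = 1" | "2 \<le> k" by linarith
    then show ?case
    proof cases
      case 1
      then show ?thesis using P0[THEN spec, of i] less.prems marg_mix[of "{1..d}" "{i}"] by simp
    next
      case 2
      then show ?thesis
        using P1[THEN spec, of i] less.prems marg_mix[of "{1..d}" "{i, i + 1}"] by (simp add: atLeastAtMostSuc_conv insert_commute)
    next
      case 3
      define M where "M = {i+1..i+k-1}"
      have IH: "P i (k - 1) = mix {i..i+k-1}" "P (i + 1) (k - 1) = mix {i+1..i+k}"
        "P (i + 1) (k - 2) = mix M"
      proof -
        have "i + (k - 1) = i + k - 1" "i + 1 + (k - 1) = i + k" "i + 1 + (k - 2) = i + k - 1"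
          using 3 by auto
        then show "P i (k - 1) = mix {i..i+k-1}" "P (i + 1) (k - 1) = mix {i+1..i+k}" "P (i + 1) (k - 2) = mix M"
          using less.IH[of "k - 1" i] less.IH[of "k - 1" "i + 1"] less.IH[of "k - 2" "i + 1"] 3 less.prems
          unfolding M_def by auto
      qed
      have M: "finite M" "i + 1 \<in> M" "i \<notin> M" "i + k \<notin> M" "i \<noteq> i + k"
        using 3 by (auto simp: M_def)
      have J: "{i..i+k} = insert i (insert (i + k) M)"
        using 3 by (auto simp: M_def)
      have "2 \<le> k \<and> k \<le> d - 1 \<and> 1 \<le> i \<and> i + k \<le> d" using 3 less.prems by simp
      note step = Pk[THEN spec, THEN spec, THEN mp, OF this, folded M_def, unfolded Let_def]
      have cop: "copula_on {i..i+k} (P i k)" using step by (rule conjunct1)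
      obtain Kc K1 K2 where Kc: "rcd (mix {1..d}) M {i, i+k} Kc"
        and K1: "rcd (P i (k - 1)) M {i} K1"
        and K2: "rcd (P (i + 1) (k - 1)) M {i+k} K2"
        and cdf: "\<forall>u. (\<forall>j\<in>{i..i+k}. u j \<in> {0..1}) \<longrightarrow>
                 cdf_on {i..i+k} (P i k) u =
                 (\<integral>t. indicator {t. \<forall>m\<in>M. t m \<in> {0..u m}} t *
                       (\<integral>w. cond_cop Kc i (i+k) w (condF K1 i (u i) t) (condF K2 (i+k) (u (i+k)) t) \<partial>P (i + 1) (k - 2))
                   \<partial>P (i + 1) (k - 2))"
        using step by (elim conjE exE) (rule that)
      have "AE t in mix M. Kc t = ker (i + 1) {i, i + k} t"
        using M less.prems by (intro AE_rcd_mix[OF _ _ _ _ Kc]) (auto simp: M_def)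
      moreover have "AE t in mix M. K1 t = ker (i + 1) {i} t"
        using M by (intro AE_rcd_mix[OF _ _ _ _ K1[unfolded IH]]) (auto simp: M_def)
      moreover have "AE t in mix M. K2 t = ker (i + 1) {i + k} t"
        using M by (intro AE_rcd_mix[OF _ _ _ _ K2[unfolded IH]]) (auto simp: M_def)
      ultimately have subsum: "\<exists>T\<subseteq>set_pmf q. (\<integral>t. indicator {t. \<forall>m\<in>M. t m \<in> {0..u m}} t *
          (\<integral>w. cond_cop Kc i (i+k) w (condF K1 i (u i) t) (condF K2 (i+k) (u (i+k)) t) \<partial>mix M) \<partial>mix M)
        = (\<Sum>n\<in>T. pmf q n * (\<Prod>m\<in>{i..i+k}. F m n (u m)))" for u
        unfolding J by (rule PVC_integral_subsum[OF M _ _ _ refl])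
      show ?thesis
      proof (rule copula_subsum_eq_mix[OF _ cop])
        fix u :: "nat \<Rightarrow> real" assume "\<And>j. j \<in> {i..i+k} \<Longrightarrow> u j \<in> {0..1}"
        then show "\<exists>T\<subseteq>set_pmf q. cdf_on {i..i+k} (P i k) u = (\<Sum>n\<in>T. pmf q n * (\<Prod>j\<in>{i..i+k}. F j n (u j)))"
          using cdf[THEN spec, of u] subsum[of u] unfolding IH by simp
      qed simp
    qed
  qed
  from this[of 1 "d - 1"] show ?thesis using d by (simp add: \<nu>)
qed

end

section \<open>Stacked intervals\<close>

text \<open>\<open>Abs_pmf\<close> asks that almost every point have positive mass; the finitely
  many values of mass 0 form a null set.\<close>

lemma ex_pmf_distr_finite_range:
  assumes M: "prob_space M" and g: "g \<in> measurable M (count_space UNIV)" and fin: "finite (g ` space M)"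
  shows "\<exists>q. measure_pmf q = distr M (count_space UNIV) g \<and> finite (set_pmf q)"
proof -
  let ?N = "distr M (count_space UNIV) g"
  interpret M: prob_space M by fact
  interpret N: prob_space ?N by (rule M.prob_space_distr[OF g])
  have "AE y in ?N. \<forall>b\<in>{b \<in> g ` space M. measure ?N {b} = 0}. y \<noteq> b"
  proof (rule AE_finite_allI)
    fix b assume "b \<in> {b \<in> g ` space M. measure ?N {b} = 0}"
    then have "AE y in ?N. y \<notin> {b}" by (subst N.prob_eq_0[symmetric]) auto
    then show "AE y in ?N. y \<noteq> b" by simp
  qed (use fin in auto)
  moreover have "AE y in ?N. y \<in> g ` space M"
    by (subst AE_distr_iff[OF g]) auto
  ultimately have AE: "AE y in ?N. measure ?N {y} \<noteq> 0"
    by eventually_elim auto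
  define q where "q = Abs_pmf ?N"
  have q: "measure_pmf q = ?N"
    unfolding q_def using AE N.prob_space_axioms by (intro Abs_pmf_inverse) auto
  have "y \<in> g ` space M" if "y \<in> set_pmf q" for y
  proof (rule ccontr)
    assume "y \<notin> g ` space M"
    then have "g -` {y} \<inter> space M = {}" by auto
    then have "measure ?N {y} = 0" by (simp add: measure_distr[OF g])
    with that show False by (simp add: set_pmf.rep_eq q)
  qed
  then have "finite (set_pmf q)" by (intro finite_subset[OF _ fin]) auto
  with q show ?thesis by (intro exI[of _ q]) simp
qed

text \<open>\<open>key\<close> is the order in which the pieces are stacked along an axis; it may
  differ between coordinates, so that each axis can be sorted by its own grid layers.\<close>

definition stack_lo :: "'i pmf \<Rightarrow> ('i \<Rightarrow> nat) \<Rightarrow> 'i \<Rightarrow> real" where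
  "stack_lo q key i = (\<Sum>i'\<in>{i' \<in> set_pmf q. key i' < key i}. pmf q i')"

definition stack_interval :: "'i pmf \<Rightarrow> ('i \<Rightarrow> nat) \<Rightarrow> 'i \<Rightarrow> real set" where
  "stack_interval q key i = {stack_lo q key i <.. stack_lo q key i + pmf q i}"

text \<open>The value off the support is irrelevant; it only keeps this a probability measure.\<close>

definition stack_uniform :: "'i pmf \<Rightarrow> ('i \<Rightarrow> nat) \<Rightarrow> 'i \<Rightarrow> real measure" where
  "stack_uniform q key i = uniform_measure lborel (if i \<in> set_pmf q then stack_interval q key i else {0<..1})"

definition stack_index :: "'i pmf \<Rightarrow> ('i \<Rightarrow> nat) \<Rightarrow> real \<Rightarrow> 'i" where
  "stack_index q key x = (THE i. i \<in> set_pmf q \<and> x \<in> stack_interval q key i)"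

lemma measure_uniform_Ioc_atMost:
  fixes a b :: real
  assumes "a < b"
  shows "measure (uniform_measure lborel {a<..b}) {..x} = (max a (min b x) - a) / (b - a)"
proof -
  have "{a<..b} \<inter> {..x} = {a<..max a (min b x)}" by auto
  then show ?thesis using assms by simp
qed

context
  fixes q :: "'i pmf" and key :: "'i \<Rightarrow> nat"
  assumes fin: "finite (set_pmf q)" and inj: "inj_on key (set_pmf q)"
begin

lemma stack_hi:
  assumes "i \<in> set_pmf q"
  shows "stack_lo q key i + pmf q i = (\<Sum>i'\<in>{i' \<in> set_pmf q. key i' \<le> key i}. pmf q i')"
proof -
  have "{i' \<in> set_pmf q. key i' \<le> key i} = insert i {i' \<in> set_pmf q. key i' < key i}"
    using inj assms by (auto simp: le_less inj_on_def)
  then show ?thesis using fin by (simp add: stack_lo_def)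
qed

lemma stack_bounds:
  assumes "i \<in> set_pmf q"
  shows "0 \<le> stack_lo q key i" "stack_lo q key i + pmf q i \<le> 1"
proof -
  show "0 \<le> stack_lo q key i" unfolding stack_lo_def by (intro sum_nonneg) auto
  have "(\<Sum>i'\<in>{i' \<in> set_pmf q. key i' \<le> key i}. pmf q i') \<le> (\<Sum>i'\<in>set_pmf q. pmf q i')"
    using fin by (intro sum_mono2) auto
  also have "\<dots> = 1" using fin by (intro sum_pmf_eq_1) auto
  finally show "stack_lo q key i + pmf q i \<le> 1" by (simp add: stack_hi[OF assms])
qed

lemma stack_less:
  assumes "i \<in> set_pmf q" "i' \<in> set_pmf q" "key i < key i'"
  shows "stack_lo q key i + pmf q i \<le> stack_lo q key i'"
  unfolding stack_hi[OF assms(1)] unfolding stack_lo_def[of _ _ i']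
  using fin assms by (intro sum_mono2) auto

lemma stack_interval_unique:
  assumes "i \<in> set_pmf q" "i' \<in> set_pmf q" "x \<in> stack_interval q key i" "x \<in> stack_interval q key i'"
  shows "i = i'"
proof -
  have "\<not> key i < key i'" "\<not> key i' < key i"
    using assms stack_less[of i i'] stack_less[of i' i] by (auto simp: stack_interval_def)
  then have "key i = key i'" by simp
  then show ?thesis using inj assms by (auto dest: inj_onD)
qed

lemma stack_index_measurable: "stack_index q key \<in> measurable borel (count_space UNIV)"
  unfolding stack_index_def[abs_def]
proof (rule measurable_THE[where I = "set_pmf q"])
  show "countable (set_pmf q)" by (rule countable_set_pmf)
  show "Measurable.pred borel (\<lambda>x. i \<in> set_pmf q \<and> x \<in> stack_interval q key i)" for i
    unfolding stack_interval_def by measurable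
qed (use stack_interval_unique in \<open>blast+\<close>)

text \<open>The intervals are disjoint and lie in (0,1], so their parts up to \<open>u\<close> have
  total length at most \<open>u\<close> and their parts beyond it at most \<open>1 - u\<close>. All
  lengths add up to 1, so both bounds are attained.\<close>

lemma sum_stack_intervals_atMost:
  assumes u: "u \<in> {0..1}"
  shows "(\<Sum>i\<in>set_pmf q. measure lborel (stack_interval q key i \<inter> {..u})) = u"
proof -
  have le: "(\<Sum>i\<in>set_pmf q. measure lborel (stack_interval q key i \<inter> B)) \<le> y - x"
    if B: "B \<in> sets borel" "{0<..1} \<inter> B \<subseteq> {x<..y}" "x \<le> y" for B x y
  proof -
    have sub: "stack_interval q key i \<inter> B \<subseteq> {x<..y}" if "i \<in> set_pmf q" for i
    proof -
      have "stack_interval q key i \<subseteq> {0<..1}"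
        using stack_bounds[OF that] by (auto simp: stack_interval_def)
      then show ?thesis using B(2) by blast
    qed
    have s: "stack_interval q key i \<inter> B \<in> sets lborel" for i using B(1) by (simp add: stack_interval_def)
    have Ioc: "{x<..y} \<in> fmeasurable lborel" using B(3) by (simp add: fmeasurable_def)
    have fm: "stack_interval q key i \<inter> B \<in> fmeasurable lborel" if "i \<in> set_pmf q" for i
      by (rule fmeasurableI2[OF Ioc sub[OF that] s])
    have "(\<Sum>i\<in>set_pmf q. measure lborel (stack_interval q key i \<inter> B))
        = measure lborel (\<Union>i\<in>set_pmf q. stack_interval q key i \<inter> B)"
    proof (rule measure_finite_Union[symmetric, OF fin])
      show "(\<lambda>i. stack_interval q key i \<inter> B) ` set_pmf q \<subseteq> sets lborel" using s by blast
      show "disjoint_family_on (\<lambda>i. stack_interval q key i \<inter> B) (set_pmf q)"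
        using stack_interval_unique unfolding disjoint_family_on_def by blast
      show "emeasure lborel (stack_interval q key i \<inter> B) \<noteq> \<infinity>" if "i \<in> set_pmf q" for i
        using fm[OF that] by (auto simp: fmeasurable_def)
    qed
    also have "\<dots> \<le> measure lborel {x<..y}"
      using sub s fin by (intro measure_mono_fmeasurable[OF _ _ Ioc] sets.finite_UN) auto
    finally show ?thesis using B(3) by simp
  qed
  have split: "measure lborel (stack_interval q key i \<inter> {..u}) + measure lborel (stack_interval q key i \<inter> {u<..}) = pmf q i" for i
  proof -
    define a p where "a = stack_lo q key i" and "p = pmf q i"
    have p: "0 \<le> p" by (simp add: p_def)
    have "stack_interval q key i \<inter> {..u} = {a <.. max a (min (a + p) u)}"
      "stack_interval q key i \<inter> {u<..} = {min (a + p) (max a u) <.. a + p}"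
      by (auto simp: stack_interval_def a_def p_def)
    then have "measure lborel (stack_interval q key i \<inter> {..u}) = max a (min (a + p) u) - a"
      "measure lborel (stack_interval q key i \<inter> {u<..}) = a + p - min (a + p) (max a u)"
      by simp_all
    then show ?thesis
      unfolding p_def[symmetric] using p by linarith
  qed
  have "(\<Sum>i\<in>set_pmf q. measure lborel (stack_interval q key i \<inter> {..u}))
      + (\<Sum>i\<in>set_pmf q. measure lborel (stack_interval q key i \<inter> {u<..})) = 1"
  proof -
    have "(\<Sum>i\<in>set_pmf q. pmf q i) = 1" using fin by (intro sum_pmf_eq_1) auto
    then show ?thesis by (simp only: sum.distrib[symmetric] split)
  qed
  moreover have "(\<Sum>i\<in>set_pmf q. measure lborel (stack_interval q key i \<inter> {..u})) \<le> u - 0"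
    using u by (intro le) auto
  moreover have "(\<Sum>i\<in>set_pmf q. measure lborel (stack_interval q key i \<inter> {u<..})) \<le> 1 - u"
    using u by (intro le) auto
  ultimately show ?thesis by linarith
qed

end

text \<open>The weight \<open>pmf q i\<close> is the length of the interval and cancels the
  normalisation of the uniform law: the weighted margins are Lebesgue measure on the intervals and
  add up to the uniform law.\<close>

lemma disjoint_mixture_stack:
  fixes key :: "nat \<Rightarrow> 'i \<Rightarrow> nat"
  assumes fin: "finite (set_pmf q)" and inj: "\<And>j. inj_on (key j) (set_pmf q)"
  shows "disjoint_mixture q (\<lambda>j. stack_uniform q (key j)) (\<lambda>j. stack_index q (key j))"
proof (rule disjoint_mixture.intro)
  have carrier: "\<exists>a b. 0 \<le> a \<and> a < b \<and> b \<le> 1 \<and> stack_uniform q (key j) i = uniform_measure lborel {a<..b}" for j i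
  proof (cases "i \<in> set_pmf q")
    case True
    then have "stack_uniform q (key j) i = uniform_measure lborel {stack_lo q (key j) i <.. stack_lo q (key j) i + pmf q i}"
      by (simp add: stack_uniform_def stack_interval_def)
    moreover have "stack_lo q (key j) i < stack_lo q (key j) i + pmf q i"
      using pmf_positive[OF True] by simp
    ultimately show ?thesis
      using stack_bounds[OF fin inj True, of j] by blast
  next
    case False
    then show ?thesis by (intro exI[of _ 0] exI[of _ 1]) (auto simp: stack_uniform_def)
  qed
  show "prob_space (stack_uniform q (key j) i)" for j i
    using carrier[of j i] by (auto intro!: prob_space_uniform_measure)
  show "sets (stack_uniform q (key j) i) = sets borel" for j i
    by (simp add: stack_uniform_def)
  show "AE x in stack_uniform q (key j) i. 0 < x \<and> x \<le> 1" for j i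
  proof -
    obtain a b where ab: "0 \<le> a" "b \<le> 1" "stack_uniform q (key j) i = uniform_measure lborel {a<..b}"
      using carrier[of j i] by blast
    show ?thesis unfolding ab(3) by (rule AE_uniform_measureI) (use ab in auto)
  qed
  show "continuous_on UNIV (\<lambda>x. measure (stack_uniform q (key j) i) {..x})" for j i
  proof -
    obtain a b where ab: "a < b" "stack_uniform q (key j) i = uniform_measure lborel {a<..b}"
      using carrier[of j i] by blast
    show ?thesis
      unfolding ab(2) measure_uniform_Ioc_atMost[OF ab(1)] using ab(1) by (intro continuous_intros) auto
  qed
  show "stack_index q (key j) \<in> measurable borel (count_space UNIV)" for j
    by (rule stack_index_measurable[OF fin inj])
  show "AE x in stack_uniform q (key j) i. stack_index q (key j) x = i" if i: "i \<in> set_pmf q" for j i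
  proof -
    have "stack_index q (key j) x = i" if "x \<in> stack_interval q (key j) i" for x
      unfolding stack_index_def using i that stack_interval_unique[OF fin inj[of j]]
      by (intro the_equality conjI) blast+
    moreover have "stack_interval q (key j) i \<in> sets lborel" by (simp add: stack_interval_def)
    ultimately show ?thesis
      unfolding stack_uniform_def using i by (simp add: AE_uniform_measureI)
  qed
  show "(\<Sum>i\<in>set_pmf q. pmf q i * measure (stack_uniform q (key j) i) {..u}) = u" if u: "u \<in> {0..1}" for j u
  proof -
    have "pmf q i * measure (stack_uniform q (key j) i) {..u} = measure lborel (stack_interval q (key j) i \<inter> {..u})"
      if i: "i \<in> set_pmf q" for i
      using i pmf_positive[OF i] by (simp add: stack_uniform_def stack_interval_def)
    then show ?thesis using sum_stack_intervals_atMost[OF fin inj u] by simp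
  qed
qed (rule fin)

section \<open>Approximation of copulas by mixtures\<close>

text \<open>Coordinate j of the grid cell containing x, counted from 1: the cell \<open>m\<close> is
  \<open>((m - 1) / N, m / N]\<close>.\<close>

definition grid_cell :: "nat set \<Rightarrow> nat \<Rightarrow> (nat \<Rightarrow> real) \<Rightarrow> nat \<Rightarrow> nat" where
  "grid_cell J N x = (\<lambda>j\<in>J. min N (nat \<lceil>real N * x j\<rceil>))"

lemma grid_cell_le_iff:
  assumes "0 < N" "m \<le> N" "x j \<le> 1" "j \<in> J"
  shows "grid_cell J N x j \<le> m \<longleftrightarrow> x j \<le> real m / real N"
proof (cases "m = N")
  case True
  then show ?thesis using assms by (simp add: grid_cell_def)
next
  case False
  then have "grid_cell J N x j \<le> m \<longleftrightarrow> nat \<lceil>real N * x j\<rceil> \<le> m"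
    using assms by (auto simp: grid_cell_def)
  also have "\<dots> \<longleftrightarrow> real N * x j \<le> real m"
    by (simp add: nat_le_iff ceiling_le_iff)
  finally show ?thesis using assms by (simp add: field_simps)
qed

text \<open>\<open>min N\<close> and \<open>nat\<close> act only on points outside the unit cube,
  where they keep the range finite; thereby the law of the cell has finite support.\<close>

lemma grid_cell_measurable:
  assumes "finite J"
  shows "grid_cell J N \<in> measurable (cube J) (count_space UNIV)"
    and "finite (range (grid_cell J N))"
proof -
  let ?T = "\<Pi>\<^sub>E j\<in>J. {..N}"
  have fin: "finite ?T" using assms by (intro finite_PiE) auto
  have mem: "grid_cell J N x \<in> ?T" for x by (auto simp: grid_cell_def)
  then show "finite (range (grid_cell J N))" by (intro finite_subset[OF _ fin]) auto
  have "grid_cell J N \<in> measurable (cube J) (count_space ?T)"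
  proof (rule measurable_count_space_eq2[OF fin, THEN iffD2], intro conjI ballI)
    show "grid_cell J N \<in> space (cube J) \<rightarrow> ?T" using mem by auto
    fix I assume I: "I \<in> ?T"
    have "{x \<in> space (cube J). \<forall>j\<in>J. min N (nat \<lceil>real N * x j\<rceil>) = I j} \<in> sets (cube J)"
      using assms by measurable
    moreover have "grid_cell J N x = I \<longleftrightarrow> (\<forall>j\<in>J. min N (nat \<lceil>real N * x j\<rceil>) = I j)" for x
    proof
      assume "\<forall>j\<in>J. min N (nat \<lceil>real N * x j\<rceil>) = I j"
      then show "grid_cell J N x = I"
        by (intro PiE_ext[OF mem I]) (auto simp: grid_cell_def)
    qed (auto simp: grid_cell_def)
    ultimately show "grid_cell J N -` {I} \<inter> space (cube J) \<in> sets (cube J)"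
      by (simp add: vimage_def Int_def conj_commute)
  qed
  moreover have "(\<lambda>I. I) \<in> measurable (count_space ?T) (count_space UNIV)" by simp
  ultimately show "grid_cell J N \<in> measurable (cube J) (count_space UNIV)"
    by (rule measurable_compose)
qed

text \<open>\<open>q\<close> is the law of the grid cell under \<open>C\<close>. At grid points both
  distribution functions count the same cells, hence agree; the Lipschitz bound carries this over to
  the whole cube.\<close>

lemma ex_disjoint_mixture_near:
  assumes J: "finite J" and C: "copula_on J C" and \<eta>: "0 < \<eta>"
  shows "\<exists>(q :: (nat \<Rightarrow> nat) pmf) U idx. disjoint_mixture q U idx \<and>
    (\<forall>u. (\<forall>j\<in>J. u j \<in> {0..1}) \<longrightarrow> \<bar>cdf_on J (disjoint_mixture.mix q U J) u - cdf_on J C u\<bar> \<le> \<eta>)"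
proof -
  interpret C: prob_space C using C by (simp add: copula_on_def)
  have sets_C: "sets C = sets (cube J)" using C by (simp add: copula_on_def)
  \<comment> \<open>Moving to a grid point costs at most \<open>card J / N\<close> for the mixture
    and the same again for \<open>C\<close>, whence the factor 2; the 1 keeps \<open>N\<close>
    positive.\<close>
  obtain N :: nat where N: "max 1 (2 * card J / \<eta>) \<le> real N"
    using real_arch_simple by blast
  then have N0: "0 < N" by simp
  have N\<eta>: "2 * (card J / N) \<le> \<eta>" using N \<eta> N0 by (simp add: field_simps)
  let ?g = "grid_cell J N"
  have g: "?g \<in> measurable C (count_space UNIV)"
    using grid_cell_measurable(1)[OF J] sets_C by (simp cong: measurable_cong_sets)
  obtain q where q: "measure_pmf q = distr C (count_space UNIV) ?g" and fin: "finite (set_pmf q)"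
    using ex_pmf_distr_finite_range[OF C.prob_space_axioms g] grid_cell_measurable(2)[OF J]
    by (meson finite_subset image_mono subset_UNIV)
  \<comment> \<open>Applied to a single coordinate, to locate the stacked intervals, and to
    \<open>L = J\<close>, to compare the distribution functions.\<close>
  have grid: "measure q {I. \<forall>j\<in>L. I j \<le> m j} = measure C {x \<in> space C. \<forall>j\<in>L. x j \<le> real (m j) / N}"
    if L: "L \<subseteq> J" and m: "\<And>j. j \<in> L \<Longrightarrow> m j \<le> N" for L m
  proof -
    have "measure q {I. \<forall>j\<in>L. I j \<le> m j} = measure C (?g -` {I. \<forall>j\<in>L. I j \<le> m j} \<inter> space C)"
      unfolding q by (rule measure_distr[OF g]) simp
    also have "\<dots> = measure C {x \<in> space C. \<forall>j\<in>L. x j \<le> real (m j) / N}"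
    proof (rule measure_eq_AE)
      have "AE x in C. \<forall>j\<in>J. 0 < x j \<and> x j \<le> 1"
        using J copula_on_AE[OF C] by (intro AE_finite_allI) auto
      with AE_space show "AE x in C. (x \<in> ?g -` {I. \<forall>j\<in>L. I j \<le> m j} \<inter> space C)
          = (x \<in> {x \<in> space C. \<forall>j\<in>L. x j \<le> real (m j) / N})"
      proof eventually_elim
        case (elim x)
        then have "?g x j \<le> m j \<longleftrightarrow> x j \<le> real (m j) / N" if "j \<in> L" for j
          using that L m N0 by (intro grid_cell_le_iff) auto
        with elim show ?case by simp
      qed
      show "?g -` {I. \<forall>j\<in>L. I j \<le> m j} \<inter> space C \<in> C.events"
        using g by (rule measurable_sets) simp
      have "{x \<in> space (cube J). \<forall>j\<in>L. x j \<le> real (m j) / N} \<in> sets (cube J)"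
        using finite_subset[OF L J] by measurable (use L in auto)
      then show "{x \<in> space C. \<forall>j\<in>L. x j \<le> real (m j) / N} \<in> C.events"
        using sets_C sets_eq_imp_space_eq[OF sets_C] by simp
    qed
    finally show ?thesis .
  qed
  have sum_pmf: "(\<Sum>I\<in>{I \<in> set_pmf q. Q I}. pmf q I) = measure q {I. Q I}" for Q
  proof -
    have "measure q {I. Q I} = measure q ({I. Q I} \<inter> set_pmf q)" by (rule measure_Int_set_pmf[symmetric])
    also have "\<dots> = (\<Sum>I\<in>{I. Q I} \<inter> set_pmf q. pmf q I)" using fin by (intro measure_measure_pmf_finite) auto
    also have "{I. Q I} \<inter> set_pmf q = {I \<in> set_pmf q. Q I}" by auto
    finally show ?thesis ..
  qed
  obtain r and n :: nat where r: "r ` set_pmf q = {i. i < n}" "inj_on r (set_pmf q)"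
    using finite_imp_inj_to_nat_seg[OF fin] by auto
  have rn: "r I < n" if "I \<in> set_pmf q" for I using r(1) that by auto
  \<comment> \<open>Lexicographic order: the layer \<open>I j\<close> decides, and the numbering
    \<open>r I < n\<close> separates cells of the same layer.\<close>
  define key where "key j I = I j * n + r I" for j :: nat and I :: "nat \<Rightarrow> nat"
  have inj: "inj_on (key j) (set_pmf q)" for j
  proof (rule inj_onI)
    fix I I' assume I: "I \<in> set_pmf q" "I' \<in> set_pmf q" and "key j I = key j I'"
    then have "key j I mod n = key j I' mod n" by simp
    then have "r I = r I'" using rn[OF I(1)] rn[OF I(2)] by (simp add: key_def)
    then show "I = I'" using r(2) I by (auto dest: inj_onD)
  qed
  have key_less: "key j I' < key j I" if "I' \<in> set_pmf q" "I' j < I j" for j I I'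
  proof -
    have "key j I' < Suc (I' j) * n" using rn[OF that(1)] by (simp add: key_def)
    also have "\<dots> \<le> I j * n" using that by (intro mult_right_mono) auto
    finally show ?thesis by (simp add: key_def)
  qed
  define U where "U j = stack_uniform q (key j)" for j
  interpret D: disjoint_mixture q U "\<lambda>j. stack_index q (key j)"
    unfolding U_def[abs_def] by (rule disjoint_mixture_stack[OF fin inj])
  have F: "D.F j I (real m / N) = (if I j \<le> m then 1 else 0)"
    if I: "I \<in> set_pmf q" and j: "j \<in> J" and m: "m \<le> N" for j I m
  proof -
    let ?lo = "stack_lo q (key j) I"
    \<comment> \<open>As \<open>C\<close> has uniform margins, the layers up to \<open>m\<close>
      have total mass \<open>m / N\<close>. So the stack reaches the height \<open>m / N\<close>
      exactly between two layers and no interval straddles it.\<close>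
    have level: "(\<Sum>I'\<in>{I' \<in> set_pmf q. I' j \<le> m}. pmf q I') = real m / N"
      using grid[of "{j}" "\<lambda>_. m"] sum_pmf[of "\<lambda>I. I j \<le> m"] C j m N0 by (simp add: copula_on_def)
    have D: "D.F j I (real m / N) = (max ?lo (min (?lo + pmf q I) (real m / N)) - ?lo) / pmf q I"
      using measure_uniform_Ioc_atMost[of ?lo "?lo + pmf q I"] I pmf_positive[OF I]
      by (simp add: D.F_def U_def stack_uniform_def stack_interval_def)
    show ?thesis
    proof (cases "I j \<le> m")
      case True
      have "?lo + pmf q I \<le> (\<Sum>I'\<in>{I' \<in> set_pmf q. I' j \<le> m}. pmf q I')"
        unfolding stack_hi[OF fin inj I]
      proof (rule sum_mono2)
        show "{I' \<in> set_pmf q. key j I' \<le> key j I} \<subseteq> {I' \<in> set_pmf q. I' j \<le> m}"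
          using key_less[OF I, of j] True by (fastforce simp: not_less[symmetric])
      qed (use fin in auto)
      then show ?thesis using True D pmf_positive[OF I] by (simp add: level)
    next
      case False
      have "(\<Sum>I'\<in>{I' \<in> set_pmf q. I' j \<le> m}. pmf q I') \<le> ?lo"
        unfolding stack_lo_def using False key_less[of _ j I] fin by (intro sum_mono2) auto
      then show ?thesis using False D by (simp add: level)
    qed
  qed
  have agree: "cdf_on J (D.mix J) (\<lambda>j. real (m j) / N) = cdf_on J C (\<lambda>j. real (m j) / N)"
    if m: "\<And>j. j \<in> J \<Longrightarrow> m j \<le> N" for m
  proof -
    have "(\<Prod>j\<in>J. D.F j I (real (m j) / N)) = (if \<forall>j\<in>J. I j \<le> m j then 1 else 0)" if "I \<in> set_pmf q" for I
    proof -
      have "(\<Prod>j\<in>J. D.F j I (real (m j) / N)) = (\<Prod>j\<in>J. if I j \<le> m j then 1 else 0)"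
        using F[OF that] m by (intro prod.cong) auto
      also have "\<dots> = (if \<forall>j\<in>J. I j \<le> m j then 1 else 0)"
        using J by (auto intro: prod_zero)
      finally show ?thesis .
    qed
    then have "cdf_on J (D.mix J) (\<lambda>j. real (m j) / N) = (\<Sum>I\<in>set_pmf q. if \<forall>j\<in>J. I j \<le> m j then pmf q I else 0)"
      unfolding D.cdf_mix[OF J] by (intro sum.cong) auto
    also have "\<dots> = measure q {I. \<forall>j\<in>J. I j \<le> m j}"
      using fin by (simp add: sum_pmf[symmetric] sum.inter_filter)
    also have "\<dots> = cdf_on J C (\<lambda>j. real (m j) / N)"
      using grid[of J m] m by (simp add: cdf_on_def)
    finally show ?thesis .
  qed
  have "\<bar>cdf_on J (D.mix J) u - cdf_on J C u\<bar> \<le> \<eta>" if u: "\<forall>j\<in>J. u j \<in> {0..1}" for u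
  proof -
    define m where "m j = nat \<lfloor>real N * u j\<rfloor>" for j
    define v where "v j = real (m j) / N" for j
    have bounds: "v j \<le> u j" "u j - v j \<le> 1 / N" "m j \<le> N" if "j \<in> J" for j
    proof -
      have u': "0 \<le> u j" "u j \<le> 1" using u that by auto
      then have Nu: "0 \<le> real N * u j" "real N * u j \<le> real N" by (auto simp: mult_left_le)
      then have "0 \<le> \<lfloor>real N * u j\<rfloor>" by simp
      then have rm: "real (m j) = of_int \<lfloor>real N * u j\<rfloor>" by (simp add: m_def)
      then have m: "real (m j) \<le> real N * u j" "real N * u j \<le> real (m j) + 1"
        by linarith+
      then show "v j \<le> u j" using N0 by (simp add: v_def field_simps)
      have "u j \<le> (real (m j) + 1) / N" using m(2) N0 by (simp add: field_simps)
      then show "u j - v j \<le> 1 / N" by (simp add: v_def add_divide_distrib)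
      show "m j \<le> N" using m Nu by linarith
    qed
    have v: "v j \<in> {0..1}" if "j \<in> J" for j
      using bounds[OF that] u that by (auto simp: v_def intro: order_trans)
    have "(\<Sum>j\<in>J. \<bar>u j - v j\<bar>) \<le> (\<Sum>j\<in>J. 1 / N)"
      using bounds by (intro sum_mono) auto
    then have uv: "(\<Sum>j\<in>J. \<bar>u j - v j\<bar>) \<le> card J / N" by simp
    have "\<bar>cdf_on J (D.mix J) u - cdf_on J (D.mix J) v\<bar> \<le> (\<Sum>j\<in>J. \<bar>u j - v j\<bar>)"
      "\<bar>cdf_on J C u - cdf_on J C v\<bar> \<le> (\<Sum>j\<in>J. \<bar>u j - v j\<bar>)"
      using u v by (auto intro!: copula_cdf_lipschitz J D.copula_mix C)
    moreover have "cdf_on J (D.mix J) v = cdf_on J C v"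
      unfolding v_def using bounds by (intro agree) auto
    ultimately show ?thesis using uv N\<eta> by linarith
  qed
  then show ?thesis using D.disjoint_mixture_axioms by blast
qed

section \<open>Uniform distance and the discontinuity of \<psi>\<close>

text \<open>The recursion states the copula property from \<open>k = 2\<close> on, and
  \<open>3 \<le> d\<close> puts the full block, with \<open>k = d - 1\<close>, into its
  range.\<close>

lemma is_PVC_copula:
  assumes "3 \<le> d" "is_PVC d \<mu> \<nu>"
  shows "copula_on {1..d} \<nu>"
proof -
  have "copula_on {1..1 + (d - 1)} \<nu>"
    using assms(2) unfolding is_PVC_def
  proof (elim exE conjE, goal_cases)
    case (1 P)
    then show ?case
      using 1(3)[THEN spec[of _ "d - 1"], THEN spec[of _ 1], THEN mp, THEN conjunct1] assms(1) by simp
  qed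
  then show ?thesis using assms(1) by simp
qed

lemma dinf_upper:
  assumes "copula_on {1..d} \<mu>" "copula_on {1..d} \<nu>" "\<forall>j\<in>{1..d}. u j \<in> {0..1}"
  shows "\<bar>cdf_on {1..d} \<mu> u - cdf_on {1..d} \<nu> u\<bar> \<le> dinf d \<mu> \<nu>"
  unfolding dinf_def
proof (rule cSUP_upper)
  have bounds: "0 \<le> cdf_on {1..d} M u" "cdf_on {1..d} M u \<le> 1" if "copula_on {1..d} M" for M u
    using that prob_space.prob_le_1[of M] by (auto simp: cdf_on_def copula_on_def)
  show "bdd_above ((\<lambda>u. \<bar>cdf_on {1..d} \<mu> u - cdf_on {1..d} \<nu> u\<bar>) ` {u. \<forall>j\<in>{1..d}. u j \<in> {0..1}})"
  proof (rule bdd_aboveI2)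
    show "\<bar>cdf_on {1..d} \<mu> u - cdf_on {1..d} \<nu> u\<bar> \<le> 1" for u
      using bounds[OF assms(1), of u] bounds[OF assms(2), of u] by linarith
  qed
qed (use assms in simp)

lemma dinf_least:
  assumes "\<And>u. \<forall>j\<in>{1..d}. u j \<in> {0..1} \<Longrightarrow> \<bar>cdf_on {1..d} \<mu> u - cdf_on {1..d} \<nu> u\<bar> \<le> c"
  shows "dinf d \<mu> \<nu> \<le> c"
  unfolding dinf_def using assms by (intro cSUP_least) (auto intro: exI[of _ "\<lambda>_. 0"])

theorem theorem7p7:
  fixes d :: nat
    and \<psi> :: "(nat \<Rightarrow> real) measure \<Rightarrow> (nat \<Rightarrow> real) measure"
    and C :: "(nat \<Rightarrow> real) measure"
  assumes "3 \<le> d"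
    and psi: "\<forall>D\<in>Cc d. is_PVC d D (\<psi> D)"
    and "C \<in> Cc d"
    and "dinf d C (\<psi> C) \<noteq> 0"
  shows "\<exists>\<epsilon>>0. \<forall>\<delta>>0. \<exists>D\<in>Cc d. dinf d D C < \<delta> \<and> \<epsilon> \<le> dinf d (\<psi> D) (\<psi> C)"
proof -
  have C: "copula_on {1..d} C" using assms(3) by (simp add: Cc_def)
  have \<psi>C: "copula_on {1..d} (\<psi> C)"
    using is_PVC_copula[OF assms(1)] psi assms(3) by blast
  have "0 \<le> dinf d C (\<psi> C)"
    using dinf_upper[OF C \<psi>C, of "\<lambda>_. 0"] by simp
  then have pos: "0 < dinf d C (\<psi> C) / 2" using assms(4) by simp
  have "\<exists>D\<in>Cc d. dinf d D C < \<delta> \<and> dinf d C (\<psi> C) / 2 \<le> dinf d (\<psi> D) (\<psi> C)" if "0 < \<delta>" for \<delta>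
  proof -
    \<comment> \<open>Half of \<open>\<delta>\<close> gives the strict bound; half of the distance
      between \<open>C\<close> and \<open>\<psi> C\<close> is what the triangle inequality leaves as
      a jump, the same for all \<open>\<delta>\<close>.\<close>
    define \<eta> where "\<eta> = min (\<delta> / 2) (dinf d C (\<psi> C) / 2)"
    have \<eta>: "0 < \<eta>" "\<eta> < \<delta>" "\<eta> \<le> dinf d C (\<psi> C) / 2" using that pos by (auto simp: \<eta>_def)
    obtain q :: "(nat \<Rightarrow> nat) pmf" and U idx where "disjoint_mixture q U idx"
      and near: "\<And>u. \<forall>j\<in>{1..d}. u j \<in> {0..1} \<Longrightarrow>
        \<bar>cdf_on {1..d} (disjoint_mixture.mix q U {1..d}) u - cdf_on {1..d} C u\<bar> \<le> \<eta>"
      using ex_disjoint_mixture_near[OF _ C \<eta>(1)] by auto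
    then interpret disjoint_mixture q U idx by simp
    let ?D = "mix {1..d}"
    have D: "?D \<in> Cc d" by (rule mix_in_Cc)
    \<comment> \<open>\<open>\<psi>\<close> selects some partial vine copula of the mixture, and the
      mixture itself is the only candidate.\<close>
    have \<psi>D: "\<psi> ?D = ?D"
      using psi D assms(1) by (intro is_PVC_mix) auto
    have "dinf d ?D C \<le> \<eta>" using near by (rule dinf_least)
    moreover have "dinf d C (\<psi> C) \<le> \<eta> + dinf d ?D (\<psi> C)"
    proof (rule dinf_least)
      fix u :: "nat \<Rightarrow> real" assume u: "\<forall>j\<in>{1..d}. u j \<in> {0..1}"
      show "\<bar>cdf_on {1..d} C u - cdf_on {1..d} (\<psi> C) u\<bar> \<le> \<eta> + dinf d ?D (\<psi> C)"
        using near[OF u] dinf_upper[OF copula_mix \<psi>C u] by linarith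
    qed
    ultimately have "dinf d ?D C < \<delta> \<and> dinf d C (\<psi> C) / 2 \<le> dinf d (\<psi> ?D) (\<psi> C)"
      unfolding \<psi>D using \<eta> by linarith
    with D show ?thesis by blast
  qed
  then show ?thesis using pos by blast
qed

end
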